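(* Let $H$ be a cocommutative Hopf algebra over a field $\mathbf{k}$. There is a one-to-one correspondence between strict $L_\infty$ $H$-pseudoalgebras and crossed modules of Lie $H$-pseudoalgebras.
   Context: Polylinear maps. $H^{\otimes n}$ is a right $H$-module via $(h_1\otimes\cdots\otimes h_n)h=h_1h_{(1)}\otimes\cdots\otimes h_nh_{(n)}$. For left $H$-modules, $\mathrm{Hom}_{H^{\otimes n}}(L_1\boxtimes\cdots\boxtimes L_n,H^{\otimes n}\otimes_HM)$ is the space of $H^{\otimes n}$-linear maps $L_1\otimes\cdots\otimes L_n\to H^{\otimes n}\otimes_HM$ ($H^{\otimes n}$ acts factorwise on the source, by left multiplication on the target); its elements are called polylinear. Composition: if $\psi(y_1,\dots,y_l)=\sum_i(h_i^1\otimes\cdots\otimes h_i^l)\otimes_He_i$ and $\varphi(x_1,\dots,x_{m-1},e_i,x_{m+1},\dots,x_k)=\sum_j(f^1_{ij}\otimes\cdots\otimes f^k_{ij})\otimes_He_{ij}$, then $\varphi(x_1,\dots,x_{m-1},\psi(y_1,\dots,y_l),x_{m+1},\dots,x_k)=\sum_{i,j}(f^1_{ij}\otimes\cdots\otimes f^{m-1}_{ij}\otimes h_i^1f^m_{ij(1)}\otimes\cdots\otimes h^l_if^m_{ij(l)}\otimes f^{m+1}_{ij}\otimes\cdots\otimes f^k_{ij})\otimes_He_{ij}$. $H$-linear maps are applied to $H^{\otimes n}\otimes_HM$ through the second factor. Slot convention: each factor of $H^{\otimes N}$ is attached to one argument; in identities whose terms involve the same elements in different orders, the $H$-factors are permuted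 so that they appear in one fixed order of the elements (well defined by cocommutativity). Skew-symmetric means: under this convention, exchanging two arguments changes the sign. A Lie $H$-pseudoalgebra is a left $H$-module $L$ with a skew-symmetric polylinear map (pseudobracket) $[\cdot*\cdot]:L\boxtimes L\to H^{\otimes2}\otimes_HL$ satisfying $[[x*y]*z]=[x*[y*z]]-[y*[x*z]]$. A morphism $\theta:L\to L'$ is an $H$-linear map with $(\mathrm{id}_{H^{\otimes2}}\otimes_H\theta)[x*y]=[\theta(x)*\theta(y)]'$. A representation of $L$ is a left $H$-module $M$ with polylinear $\gamma:L\boxtimes M\to H^{\otimes2}\otimes_HM$ satisfying $\gamma([x*y],u)=\gamma(x,\gamma(y,u))-\gamma(y,\gamma(x,u))$. A crossed module of Lie $H$-pseudoalgebras is a quadruple $(L,L',\varphi,\gamma)$: Lie $H$-pseudoalgebras $L,L'$ with pseudobrackets $[\cdot*\cdot],[\cdot*\cdot]'$, a morphism $\varphi:L'\to L$ and a polylinear $\gamma:L\boxtimes L'\to H^{\otimes2}\otimes_HL'$ making $L'$ a representation of $L$, such that for $x\in L$, $x',y',z'\in L'$: $(\mathrm{id}_{H^{\otimes2}}\otimes_H\varphi)(\gamma(x,y'))=[x*\varphi(y')]$, $\gamma(\varphi(x'),y')=[x'*y']'$ and $[\gamma(x,y')*z']'=\gamma(x,[y'*z']')-[y'*\gamma(x,z')]'$. A $2$-term $L_\infty$ $H$-pseudoalgebra $(\mathcal{L}_1\xrightarrow{\beta_1}\mathcal{L}_0,\beta_2,\beta_3)$: left $H$-modules $\mathcal{L}_0,\mathcal{L}_1$,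 an $H$-linear map $\beta_1$, a skew-symmetric polylinear $\beta_2$ with components $\mathcal{L}_i\boxtimes\mathcal{L}_j\to H^{\otimes2}\otimes_H\mathcal{L}_{i+j}$ (zero on $\mathcal{L}_1\boxtimes\mathcal{L}_1$; $\beta_2(u,x)=-\beta_2(x,u)$ under the slot convention), and a skew-symmetric polylinear $\beta_3:\mathcal{L}_0^{\boxtimes3}\to H^{\otimes3}\otimes_H\mathcal{L}_1$, such that for $x,y,z,w\in\mathcal{L}_0$, $u,v\in\mathcal{L}_1$: (i) $\beta_1(\beta_2(x,u))=\beta_2(x,\beta_1(u))$; (ii) $\beta_2(\beta_1(u),v)=\beta_2(u,\beta_1(v))$; (iii) $\beta_2(\beta_2(x,y),z)-\beta_2(x,\beta_2(y,z))+\beta_2(y,\beta_2(x,z))=-\beta_1(\beta_3(x,y,z))$; (iv) $\beta_2(\beta_2(x,y),v)-\beta_2(x,\beta_2(y,v))+\beta_2(y,\beta_2(x,v))=-\beta_3(x,y,\beta_1(v))$; (v) $\beta_2(x,\beta_3(y,z,w))-\beta_2(y,\beta_3(x,z,w))+\beta_2(z,\beta_3(x,y,w))-\beta_2(w,\beta_3(x,y,z))-\beta_3(\beta_2(x,y),z,w)+\beta_3(\beta_2(x,z),y,w)-\beta_3(\beta_2(x,w),y,z)-\beta_3(\beta_2(y,z),x,w)+\beta_3(\beta_2(y,w),x,z)-\beta_3(\beta_2(z,w),x,y)=0$. It is called a strict $L_\infty$ $H$-pseudoalgebra if $\beta_3=0$. *)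

theory Defs
  imports Complex_Main "HOL-Library.Poly_Mapping" "HOL-Computational_Algebra.Group_Closure"
begin

text \<open>
  Tensor products are realised as quotients of free abelian groups. The free abelian group on a
  type is its type of finitely supported integer-valued functions, with basis vectors frag_of x
  and linear extension frag_extend. A residue class modulo a subgroup R is a set of the form
  coset R t; addition, subtraction and negation of residue classes are elementwise.
  (The library operators + and - are not used on classes: - on sets is set difference.)
\<close>

definition coset :: "'x::ab_group_add set \<Rightarrow> 'x \<Rightarrow> 'x set" where
  "coset R t = {s. s - t \<in> R}"

definition rep :: "'x set \<Rightarrow> 'x" where
  "rep X = (SOME t. t \<in> X)"

definition class_add :: "'x::ab_group_add set \<Rightarrow> 'x set \<Rightarrow> 'x set" (infixl "\<oplus>" 65) where
  "X \<oplus> Y = {s + t | s t. s \<in> X \<and> t \<in> Y}"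

definition class_diff :: "'x::ab_group_add set \<Rightarrow> 'x set \<Rightarrow> 'x set" (infixl "\<ominus>" 65) where
  "X \<ominus> Y = {s - t | s t. s \<in> X \<and> t \<in> Y}"

definition class_neg :: "'x::ab_group_add set \<Rightarrow> 'x set" where
  "class_neg X = uminus ` X"

text \<open>
  The map of quotients induced by the linear extension of F, with target taken modulo R.
  It does not depend on representatives as soon as the extension of F maps the source
  relations into R.
\<close>

definition induced ::
  "('y \<Rightarrow>\<^sub>0 int) set \<Rightarrow> ('x \<Rightarrow> ('y \<Rightarrow>\<^sub>0 int)) \<Rightarrow> ('x \<Rightarrow>\<^sub>0 int) set \<Rightarrow> ('y \<Rightarrow>\<^sub>0 int) set" where
  "induced R F X = coset R (frag_extend F (rep X))"

text \<open>
  The list [h1, ..., hn] stands for the pure tensor of h1, ..., hn. The ring structure of H is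
  that of the type 'h; the remaining structure is collected in a record. The comultiplication
  takes values in the residue classes forming the second tensor power of H.
\<close>

record ('k, 'h) hopf =
  scal :: "'k \<Rightarrow> 'h \<Rightarrow> 'h"
  comult :: "'h \<Rightarrow> ('h list \<Rightarrow>\<^sub>0 int) set"
  counit :: "'h \<Rightarrow> 'k"
  antipode :: "'h \<Rightarrow> 'h"

text \<open>Multiadditivity, and moving scalars between factors. Only used for n > 0.\<close>

definition hpow_rel :: "('k, 'h::ring_1) hopf \<Rightarrow> nat \<Rightarrow> ('h list \<Rightarrow>\<^sub>0 int) set" where
  "hpow_rel H n = group_closure
     ({frag_of (hs[i := a + b]) - frag_of (hs[i := a]) - frag_of (hs[i := b])
        | hs i a b. length hs = n \<and> i < n} \<union>
      {frag_of (hs[i := scal H c (hs ! i)]) - frag_of (hs[j := scal H c (hs ! j)])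
        | hs i j c. length hs = n \<and> i < n \<and> j < n})"

definition hpow :: "('k, 'h::ring_1) hopf \<Rightarrow> nat \<Rightarrow> ('h list \<Rightarrow>\<^sub>0 int) set set" where
  "hpow H n = coset (hpow_rel H n) ` {t. Poly_Mapping.keys t \<subseteq> {hs. length hs = n}}"

text \<open>A formal sum of lists [h(1), h(2)] representing the coproduct of h (Sweedler notation).\<close>

definition sweedler :: "('k, 'h::ring_1) hopf \<Rightarrow> 'h \<Rightarrow> ('h list \<Rightarrow>\<^sub>0 int)" where
  "sweedler H h = rep (comult H h)"

text \<open>A formal sum of lists [h(1), ..., h(n)] representing the iterated coproduct, n > 0.\<close>

fun coprod :: "('k, 'h::ring_1) hopf \<Rightarrow> nat \<Rightarrow> 'h \<Rightarrow> ('h list \<Rightarrow>\<^sub>0 int)" where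
  "coprod H 0 h = 0"
| "coprod H (Suc 0) h = frag_of [h]"
| "coprod H (Suc (Suc n)) h =
     frag_extend (\<lambda>ab. frag_extend (\<lambda>hs. frag_of (ab ! 0 # hs)) (coprod H (Suc n) (ab ! 1)))
       (sweedler H h)"

text \<open>The value in a ring of a formal sum under the linear extension of f.\<close>

definition lin_eval :: "('x \<Rightarrow> 'h::ring_1) \<Rightarrow> ('x \<Rightarrow>\<^sub>0 int) \<Rightarrow> 'h" where
  "lin_eval f t = (\<Sum>x\<in>Poly_Mapping.keys t. of_int (Poly_Mapping.lookup t x) * f x)"

definition assoc_algebra :: "('k::field \<Rightarrow> 'h::ring_1 \<Rightarrow> 'h) \<Rightarrow> bool" where
  "assoc_algebra s \<longleftrightarrow> vector_space s \<and>
     (\<forall>c a b. s c (a * b) = s c a * b) \<and> (\<forall>c a b. s c (a * b) = a * s c b)"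

definition cocommutative_hopf_algebra :: "('k::field, 'h::ring_1) hopf \<Rightarrow> bool" where
  "cocommutative_hopf_algebra H \<longleftrightarrow>
     assoc_algebra (scal H) \<and>
     (\<forall>h. comult H h \<in> hpow H 2) \<and>
     (\<forall>g h. comult H (g + h) = comult H g \<oplus> comult H h) \<and>
     (\<forall>c h. comult H (scal H c h) =
        induced (hpow_rel H 2) (\<lambda>ab. frag_of [scal H c (ab ! 0), ab ! 1]) (comult H h)) \<and>
     (\<forall>g h. comult H (g * h) = coset (hpow_rel H 2)
        (frag_extend (\<lambda>ab. frag_extend (\<lambda>cd. frag_of (map2 (*) ab cd)) (sweedler H h))
          (sweedler H g))) \<and>
     comult H 1 = coset (hpow_rel H 2) (frag_of [1, 1]) \<and>
     Vector_Spaces.linear (scal H) (*) (counit H) \<and>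
     (\<forall>g h. counit H (g * h) = counit H g * counit H h) \<and> counit H 1 = 1 \<and>
     (\<forall>h. coset (hpow_rel H 3)
           (frag_extend (\<lambda>ab. frag_extend (\<lambda>cd. frag_of (cd @ [ab ! 1])) (sweedler H (ab ! 0)))
             (sweedler H h)) =
          coset (hpow_rel H 3)
           (frag_extend (\<lambda>ab. frag_extend (\<lambda>cd. frag_of (ab ! 0 # cd)) (sweedler H (ab ! 1)))
             (sweedler H h))) \<and>
     (\<forall>h. lin_eval (\<lambda>ab. scal H (counit H (ab ! 0)) (ab ! 1)) (sweedler H h) = h) \<and>
     (\<forall>h. lin_eval (\<lambda>ab. scal H (counit H (ab ! 1)) (ab ! 0)) (sweedler H h) = h) \<and>
     Vector_Spaces.linear (scal H) (scal H) (antipode H) \<and>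
     (\<forall>h. lin_eval (\<lambda>ab. antipode H (ab ! 0) * ab ! 1) (sweedler H h) = scal H (counit H h) 1) \<and>
     (\<forall>h. lin_eval (\<lambda>ab. ab ! 0 * antipode H (ab ! 1)) (sweedler H h) = scal H (counit H h) 1) \<and>
     (\<forall>h. induced (hpow_rel H 2) (\<lambda>ab. frag_of [ab ! 1, ab ! 0]) (comult H h) = comult H h)"

text \<open>The k-space structure of an H-module is the one induced by the action of H.\<close>

definition left_module :: "('h::ring_1 \<Rightarrow> 'm::ab_group_add \<Rightarrow> 'm) \<Rightarrow> bool" where
  "left_module act \<longleftrightarrow>
     (\<forall>g h x. act (g + h) x = act g x + act h x) \<and>
     (\<forall>h x y. act h (x + y) = act h x + act h y) \<and>
     (\<forall>g h x. act (g * h) x = act g (act h x)) \<and> (\<forall>x. act 1 x = x)"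

definition h_linear ::
  "('h \<Rightarrow> 'm::ab_group_add \<Rightarrow> 'm) \<Rightarrow> ('h \<Rightarrow> 'n::ab_group_add \<Rightarrow> 'n) \<Rightarrow> ('m \<Rightarrow> 'n) \<Rightarrow> bool" where
  "h_linear actM actN \<theta> \<longleftrightarrow>
     (\<forall>x y. \<theta> (x + y) = \<theta> x + \<theta> y) \<and> (\<forall>h x. \<theta> (actM h x) = actN h (\<theta> x))"

text \<open>
  The n-th tensor power of H, tensored over H with M: the pair ([h1, ..., hn], m) stands for the
  tensor of h1, ..., hn over k, tensored over H with m. The relations are those of the tensor
  power of H in the first component, additivity in m, and the balancing relation for the right
  action of H by the iterated coproduct.
\<close>

type_synonym ('h, 'm) tens = "('h list \<times> 'm \<Rightarrow>\<^sub>0 int) set"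

definition tens_rel ::
  "('k, 'h::ring_1) hopf \<Rightarrow> nat \<Rightarrow> ('h \<Rightarrow> 'm::ab_group_add \<Rightarrow> 'm) \<Rightarrow> ('h, 'm) tens" where
  "tens_rel H n act = group_closure
     ({frag_extend (\<lambda>hs. frag_of (hs, m)) r | r m. r \<in> hpow_rel H n} \<union>
      {frag_of (hs, m + m') - frag_of (hs, m) - frag_of (hs, m') | hs m m'. length hs = n} \<union>
      {frag_extend (\<lambda>gs. frag_of (map2 (*) hs gs, m)) (coprod H n h) - frag_of (hs, act h m)
        | hs h m. length hs = n})"

definition tens ::
  "('k, 'h::ring_1) hopf \<Rightarrow> nat \<Rightarrow> ('h \<Rightarrow> 'm::ab_group_add \<Rightarrow> 'm) \<Rightarrow> ('h, 'm) tens set" where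
  "tens H n act =
     coset (tens_rel H n act) ` {t. Poly_Mapping.keys t \<subseteq> {(hs, m). length hs = n}}"

abbreviation tzero ::
  "('k, 'h::ring_1) hopf \<Rightarrow> nat \<Rightarrow> ('h \<Rightarrow> 'm::ab_group_add \<Rightarrow> 'm) \<Rightarrow> ('h, 'm) tens" where
  "tzero H n act \<equiv> coset (tens_rel H n act) 0"

text \<open>Left multiplication by the pure tensor of the list gs.\<close>

definition lmult ::
  "('k, 'h::ring_1) hopf \<Rightarrow> ('h \<Rightarrow> 'm::ab_group_add \<Rightarrow> 'm) \<Rightarrow> 'h list
     \<Rightarrow> ('h, 'm) tens \<Rightarrow> ('h, 'm) tens" where
  "lmult H act gs X =
     induced (tens_rel H (length gs) act) (\<lambda>(hs, m). frag_of (map2 (*) gs hs, m)) X"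

text \<open>The identity of the n-th tensor power of H tensored over H with a linear map to (N, actN).\<close>

definition id_tens ::
  "('k, 'h::ring_1) hopf \<Rightarrow> nat \<Rightarrow> ('h \<Rightarrow> 'n::ab_group_add \<Rightarrow> 'n) \<Rightarrow> ('m \<Rightarrow> 'n)
     \<Rightarrow> ('h, 'm) tens \<Rightarrow> ('h, 'n) tens" where
  "id_tens H n actN \<theta> X = induced (tens_rel H n actN) (\<lambda>(hs, m). frag_of (hs, \<theta> m)) X"

text \<open>
  Permutation of the H-factors: factor j of the result is factor (ps ! j) of the argument.
  Thus, if the arguments of a term occur in the order in which the factors of X are listed, then
  ps lists, for each argument in the fixed order, its position in the term.
\<close>

definition reorder ::
  "('k, 'h::ring_1) hopf \<Rightarrow> ('h \<Rightarrow> 'm::ab_group_add \<Rightarrow> 'm) \<Rightarrow> nat list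
     \<Rightarrow> ('h, 'm) tens \<Rightarrow> ('h, 'm) tens" where
  "reorder H act ps X =
     induced (tens_rel H (length ps) act) (\<lambda>(hs, m). frag_of (map ((!) hs) ps, m)) X"

text \<open>
  A polylinear map is given by the corresponding function of several variables: it is
  multiadditive, and each tensor factor of H acts through its own argument
  (k-multilinearity is a special case).
\<close>

definition polylinear2 ::
  "('k, 'h::ring_1) hopf \<Rightarrow> ('h \<Rightarrow> 'a::ab_group_add \<Rightarrow> 'a) \<Rightarrow> ('h \<Rightarrow> 'b::ab_group_add \<Rightarrow> 'b)
     \<Rightarrow> ('h \<Rightarrow> 'm::ab_group_add \<Rightarrow> 'm) \<Rightarrow> ('a \<Rightarrow> 'b \<Rightarrow> ('h, 'm) tens) \<Rightarrow> bool" where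
  "polylinear2 H actA actB actM f \<longleftrightarrow>
     (\<forall>x y. f x y \<in> tens H 2 actM) \<and>
     (\<forall>x x' y. f (x + x') y = f x y \<oplus> f x' y) \<and>
     (\<forall>x y y'. f x (y + y') = f x y \<oplus> f x y') \<and>
     (\<forall>g h x y. f (actA g x) (actB h y) = lmult H actM [g, h] (f x y))"

definition polylinear3 ::
  "('k, 'h::ring_1) hopf \<Rightarrow> ('h \<Rightarrow> 'a::ab_group_add \<Rightarrow> 'a) \<Rightarrow> ('h \<Rightarrow> 'b::ab_group_add \<Rightarrow> 'b)
     \<Rightarrow> ('h \<Rightarrow> 'c::ab_group_add \<Rightarrow> 'c) \<Rightarrow> ('h \<Rightarrow> 'm::ab_group_add \<Rightarrow> 'm)
     \<Rightarrow> ('a \<Rightarrow> 'b \<Rightarrow> 'c \<Rightarrow> ('h, 'm) tens) \<Rightarrow> bool" where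
  "polylinear3 H actA actB actC actM f \<longleftrightarrow>
     (\<forall>x y z. f x y z \<in> tens H 3 actM) \<and>
     (\<forall>x x' y z. f (x + x') y z = f x y z \<oplus> f x' y z) \<and>
     (\<forall>x y y' z. f x (y + y') z = f x y z \<oplus> f x y' z) \<and>
     (\<forall>x y z z'. f x y (z + z') = f x y z \<oplus> f x y z') \<and>
     (\<forall>g h k x y z. f (actA g x) (actB h y) (actC k z) = lmult H actM [g, h, k] (f x y z))"

text \<open>
  Composition of polylinear maps. Let p e be the value of a polylinear map with e inserted as its
  argument number m (counted from 0) and all other arguments fixed, and let X be the value of
  another polylinear map; then compose_at H N act m p X is the value obtained by inserting X as
  argument number m. It has N tensor factors. A term ([h1, ..., hl], e) of X and a term
  ([f1, ..., fk], e') of p e contribute the list in which the entry f = fs ! m is replaced by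
  [h1 f(1), ..., hl f(l)], together with e'.
\<close>

definition compose_at ::
  "('k, 'h::ring_1) hopf \<Rightarrow> nat \<Rightarrow> ('h \<Rightarrow> 'm::ab_group_add \<Rightarrow> 'm) \<Rightarrow> nat
     \<Rightarrow> ('e \<Rightarrow> ('h, 'm) tens) \<Rightarrow> ('h, 'e) tens \<Rightarrow> ('h, 'm) tens" where
  "compose_at H N act m p X = induced (tens_rel H N act)
     (\<lambda>(hs, e). frag_extend
        (\<lambda>(fs, e'). frag_extend
           (\<lambda>gs. frag_of (take m fs @ map2 (*) hs gs @ drop (Suc m) fs, e'))
           (coprod H (length hs) (fs ! m)))
        (rep (p e))) X"

record ('h, 'a) lie_data =
  act :: "'h \<Rightarrow> 'a \<Rightarrow> 'a"
  bracket :: "'a \<Rightarrow> 'a \<Rightarrow> ('h, 'a) tens"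

definition lie_pseudoalgebra ::
  "('k, 'h::ring_1) hopf \<Rightarrow> ('h, 'a::ab_group_add) lie_data \<Rightarrow> bool" where
  "lie_pseudoalgebra H L \<longleftrightarrow>
     left_module (act L) \<and>
     polylinear2 H (act L) (act L) (act L) (bracket L) \<and>
     (\<forall>x y. reorder H (act L) [1, 0] (bracket L y x) = class_neg (bracket L x y)) \<and>
     (\<forall>x y z.
        compose_at H 3 (act L) 0 (\<lambda>e. bracket L e z) (bracket L x y) =
        compose_at H 3 (act L) 1 (bracket L x) (bracket L y z)
        \<ominus> reorder H (act L) [1, 0, 2] (compose_at H 3 (act L) 1 (bracket L y) (bracket L x z)))"

definition lie_morphism ::
  "('k, 'h::ring_1) hopf \<Rightarrow> ('h, 'a::ab_group_add) lie_data \<Rightarrow> ('h, 'b::ab_group_add) lie_data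
     \<Rightarrow> ('a \<Rightarrow> 'b) \<Rightarrow> bool" where
  "lie_morphism H L L' \<theta> \<longleftrightarrow>
     h_linear (act L) (act L') \<theta> \<and>
     (\<forall>x y. id_tens H 2 (act L') \<theta> (bracket L x y) = bracket L' (\<theta> x) (\<theta> y))"

definition lie_representation ::
  "('k, 'h::ring_1) hopf \<Rightarrow> ('h, 'a::ab_group_add) lie_data \<Rightarrow> ('h \<Rightarrow> 'm::ab_group_add \<Rightarrow> 'm)
     \<Rightarrow> ('a \<Rightarrow> 'm \<Rightarrow> ('h, 'm) tens) \<Rightarrow> bool" where
  "lie_representation H L actM \<gamma> \<longleftrightarrow>
     left_module actM \<and>
     polylinear2 H (act L) actM actM \<gamma> \<and>
     (\<forall>x y u.
        compose_at H 3 actM 0 (\<lambda>e. \<gamma> e u) (bracket L x y) =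
        compose_at H 3 actM 1 (\<gamma> x) (\<gamma> y u)
        \<ominus> reorder H actM [1, 0, 2] (compose_at H 3 actM 1 (\<gamma> y) (\<gamma> x u)))"

record ('h, 'a, 'b) crossed_data =
  cm_base :: "('h, 'a) lie_data"
  cm_top :: "('h, 'b) lie_data"
  cm_map :: "'b \<Rightarrow> 'a"
  cm_action :: "'a \<Rightarrow> 'b \<Rightarrow> ('h, 'b) tens"

definition crossed_module ::
  "('k, 'h::ring_1) hopf \<Rightarrow> ('h, 'a::ab_group_add, 'b::ab_group_add) crossed_data \<Rightarrow> bool" where
  "crossed_module H C \<longleftrightarrow>
     (let L = cm_base C; L' = cm_top C; \<phi> = cm_map C; \<gamma> = cm_action C in
       lie_pseudoalgebra H L \<and> lie_pseudoalgebra H L' \<and>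
       lie_morphism H L' L \<phi> \<and>
       lie_representation H L (act L') \<gamma> \<and>
       (\<forall>x y'. id_tens H 2 (act L) \<phi> (\<gamma> x y') = bracket L x (\<phi> y')) \<and>
       (\<forall>x' y'. \<gamma> (\<phi> x') y' = bracket L' x' y') \<and>
       (\<forall>x y' z'.
          compose_at H 3 (act L') 0 (\<lambda>e. bracket L' e z') (\<gamma> x y') =
          compose_at H 3 (act L') 1 (\<gamma> x) (bracket L' y' z')
          \<ominus> reorder H (act L') [1, 0, 2] (compose_at H 3 (act L') 1 (bracket L' y') (\<gamma> x z'))))"

text \<open>
  The component of degree i is a module on the type 'a for i = 0 and on 'b for i = 1. beta2ij is
  the component of beta2 on degrees i and j; the component on degrees 1 and 1 is zero and hence
  not recorded.
\<close>

record ('h, 'a, 'b) linf_data =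
  act0 :: "'h \<Rightarrow> 'a \<Rightarrow> 'a"
  act1 :: "'h \<Rightarrow> 'b \<Rightarrow> 'b"
  beta1 :: "'b \<Rightarrow> 'a"
  beta200 :: "'a \<Rightarrow> 'a \<Rightarrow> ('h, 'a) tens"
  beta201 :: "'a \<Rightarrow> 'b \<Rightarrow> ('h, 'b) tens"
  beta210 :: "'b \<Rightarrow> 'a \<Rightarrow> ('h, 'b) tens"
  beta3 :: "'a \<Rightarrow> 'a \<Rightarrow> 'a \<Rightarrow> ('h, 'b) tens"

definition two_term_linf ::
  "('k, 'h::ring_1) hopf \<Rightarrow> ('h, 'a::ab_group_add, 'b::ab_group_add) linf_data \<Rightarrow> bool" where
  "two_term_linf H A \<longleftrightarrow>
     (let a0 = act0 A; a1 = act1 A; b1 = beta1 A; b00 = beta200 A; b01 = beta201 A;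
          b10 = beta210 A; b3 = beta3 A
      in
       left_module a0 \<and> left_module a1 \<and> h_linear a1 a0 b1 \<and>
       polylinear2 H a0 a0 a0 b00 \<and> polylinear2 H a0 a1 a1 b01 \<and> polylinear2 H a1 a0 a1 b10 \<and>
       (\<forall>x y. reorder H a0 [1, 0] (b00 y x) = class_neg (b00 x y)) \<and>
       (\<forall>x u. reorder H a1 [1, 0] (b10 u x) = class_neg (b01 x u)) \<and>
       polylinear3 H a0 a0 a0 a1 b3 \<and>
       (\<forall>x y z. reorder H a1 [1, 0, 2] (b3 y x z) = class_neg (b3 x y z)) \<and>
       (\<forall>x y z. reorder H a1 [0, 2, 1] (b3 x z y) = class_neg (b3 x y z)) \<and>
       (\<forall>x y z. reorder H a1 [2, 1, 0] (b3 z y x) = class_neg (b3 x y z)) \<and>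
       (\<forall>x u. id_tens H 2 a0 b1 (b01 x u) = b00 x (b1 u)) \<and>
       (\<forall>u v. b01 (b1 u) v = b10 u (b1 v)) \<and>
       (\<forall>x y z.
          compose_at H 3 a0 0 (\<lambda>e. b00 e z) (b00 x y)
          \<ominus> compose_at H 3 a0 1 (b00 x) (b00 y z)
          \<oplus> reorder H a0 [1, 0, 2] (compose_at H 3 a0 1 (b00 y) (b00 x z))
          = class_neg (id_tens H 3 a0 b1 (b3 x y z))) \<and>
       (\<forall>x y v.
          compose_at H 3 a1 0 (\<lambda>e. b01 e v) (b00 x y)
          \<ominus> compose_at H 3 a1 1 (b01 x) (b01 y v)
          \<oplus> reorder H a1 [1, 0, 2] (compose_at H 3 a1 1 (b01 y) (b01 x v))
          = class_neg (b3 x y (b1 v))) \<and>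
       (\<forall>x y z w.
          compose_at H 4 a1 1 (b01 x) (b3 y z w)
          \<ominus> reorder H a1 [1, 0, 2, 3] (compose_at H 4 a1 1 (b01 y) (b3 x z w))
          \<oplus> reorder H a1 [1, 2, 0, 3] (compose_at H 4 a1 1 (b01 z) (b3 x y w))
          \<ominus> reorder H a1 [1, 2, 3, 0] (compose_at H 4 a1 1 (b01 w) (b3 x y z))
          \<ominus> compose_at H 4 a1 0 (\<lambda>e. b3 e z w) (b00 x y)
          \<oplus> reorder H a1 [0, 2, 1, 3] (compose_at H 4 a1 0 (\<lambda>e. b3 e y w) (b00 x z))
          \<ominus> reorder H a1 [0, 2, 3, 1] (compose_at H 4 a1 0 (\<lambda>e. b3 e y z) (b00 x w))
          \<ominus> reorder H a1 [2, 0, 1, 3] (compose_at H 4 a1 0 (\<lambda>e. b3 e x w) (b00 y z))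
          \<oplus> reorder H a1 [2, 0, 3, 1] (compose_at H 4 a1 0 (\<lambda>e. b3 e x z) (b00 y w))
          \<ominus> reorder H a1 [2, 3, 0, 1] (compose_at H 4 a1 0 (\<lambda>e. b3 e x y) (b00 z w))
          = tzero H 4 a1))"

definition strict_linf ::
  "('k, 'h::ring_1) hopf \<Rightarrow> ('h, 'a::ab_group_add, 'b::ab_group_add) linf_data \<Rightarrow> bool" where
  "strict_linf H A \<longleftrightarrow> two_term_linf H A \<and> (\<forall>x y z. beta3 A x y z = tzero H 3 (act1 A))"

text \<open>
  The correspondence: L is the degree 0 part, L' the degree 1 part with pseudobracket
  beta2(beta1(u), v), the morphism is beta1 and the action is beta2 on degrees 0 and 1.
\<close>

definition crossed_of_linf ::
  "('h, 'a, 'b) linf_data \<Rightarrow> ('h, 'a, 'b) crossed_data" where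
  "crossed_of_linf A =
     \<lparr>cm_base = \<lparr>act = act0 A, bracket = beta200 A\<rparr>,
      cm_top = \<lparr>act = act1 A, bracket = (\<lambda>u v. beta201 A (beta1 A u) v)\<rparr>,
      cm_map = beta1 A,
      cm_action = beta201 A\<rparr>"

end

theory Submission
  imports Defs "HOL-Combinatorics.Permutations"
begin

text \<open>
  For vanishing third bracket, identity (iii) is the Jacobi identity of the degree 0 part and (iv)
  is the representation axiom. Substituting \<open>\<beta>\<^sub>1(u)\<close> for degree 0 arguments in (iv) and using (i)
  gives the Jacobi identity of \<open>[u * v]' = \<beta>\<^sub>2(\<beta>\<^sub>1(u), v)\<close> and the last axiom of a crossed module,
  while (ii) gives skew-symmetry. Conversely, the component of \<open>\<beta>\<^sub>2\<close> on degrees 1 and 0 is forced by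
  skew-symmetry, and all terms of (v) vanish. What requires proof is that permutation of the factors
  and composition are independent of representatives: this rests on multiplicativity,
  coassociativity and cocommutativity of the iterated coproduct.
\<close>

section \<open>Residue classes and linear extension\<close>

text \<open>Every operation on classes is computed from a representative that \<open>rep\<close>
  picks by choice, so no composite can be evaluated before independence of this choice is known. It
  is derived from the universal property of the tensor product over H
  (\<open>tens_rel_lift\<close>), where the decisive case is the balancing relation. Permuting
  factors must fix the iterated coproduct: this is cocommutativity. Applying an l-fold coproduct to
  one factor must respect products and turn the k-fold coproduct into the (k+l-1)-fold one: this is
  multiplicativity and coassociativity. For the class that is inserted into a composition,
  multiplicativity lets the balancing factor h be absorbed on the other side. The correspondence
  draws on this in three places: moving \<open>beta1\<close> through a composition, solving
  skew-symmetry for \<open>beta210\<close>, and evaluating compositions on zero classes. Since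
  classes are sets with elementwise operations, rearranging an identity also requires that its terms
  are cosets of one subgroup.\<close>

definition add_subgroup :: "'x::ab_group_add set \<Rightarrow> bool" where
  "add_subgroup R \<longleftrightarrow> 0 \<in> R \<and> (\<forall>x\<in>R. \<forall>y\<in>R. x - y \<in> R)"

lemma add_subgroup_group_closure [simp]: "add_subgroup (group_closure S)"
  by (auto simp: add_subgroup_def intro: group_closure.diff)

lemma add_subgroup_minus: "add_subgroup R \<Longrightarrow> x \<in> R \<Longrightarrow> - x \<in> R"
  by (metis add_subgroup_def diff_0)

lemma add_subgroup_add: "add_subgroup R \<Longrightarrow> x \<in> R \<Longrightarrow> y \<in> R \<Longrightarrow> x + y \<in> R"
  by (metis add_subgroup_def add_subgroup_minus diff_minus_eq_add)

lemma coset_eq_iff: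
  assumes "add_subgroup R"
  shows "coset R s = coset R t \<longleftrightarrow> s - t \<in> R"
proof
  assume "coset R s = coset R t"
  moreover have "s \<in> coset R s"
    using assms by (simp add: coset_def add_subgroup_def)
  ultimately show "s - t \<in> R"
    by (simp add: coset_def)
next
  assume st: "s - t \<in> R"
  have "x - s \<in> R \<longleftrightarrow> x - t \<in> R" for x
  proof -
    have "x - t = (x - s) + (s - t)" and "x - s = (x - t) - (s - t)"
      by simp_all
    with st assms show ?thesis
      by (metis add_subgroup_add add_subgroup_def)
  qed
  then show "coset R s = coset R t"
    by (simp add: coset_def)
qed

lemma coset_add:
  assumes "add_subgroup R"
  shows "coset R (s + t) = coset R s \<oplus> coset R t"
proof (intro equalityI subsetI)
  fix x assume "x \<in> coset R (s + t)"
  then have "x - t - s \<in> R" and "t - t \<in> R"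
    using assms by (simp_all add: coset_def add_subgroup_def algebra_simps)
  then have "x - t \<in> coset R s" and "t \<in> coset R t" and "x = (x - t) + t"
    by (simp_all add: coset_def)
  then show "x \<in> coset R s \<oplus> coset R t"
    unfolding class_add_def by blast
next
  fix x assume "x \<in> coset R s \<oplus> coset R t"
  then obtain a b where ab: "x = a + b" "a - s \<in> R" "b - t \<in> R"
    by (auto simp: class_add_def coset_def)
  have "x - (s + t) = (a - s) + (b - t)"
    using ab by simp
  then show "x \<in> coset R (s + t)"
    using add_subgroup_add [OF assms ab(2,3)] unfolding coset_def mem_Collect_eq by (simp only:)
qed

lemma mem_class_neg: "x \<in> class_neg X \<longleftrightarrow> - x \<in> X"
  by (auto simp: class_neg_def image_iff intro: bexI [of _ "- x"])

lemma coset_neg: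
  assumes "add_subgroup R"
  shows "coset R (- t) = class_neg (coset R t)"
proof (rule set_eqI)
  fix x
  have "- (x + t) = - x - t" and "x - - t = x + t"
    by simp_all
  then show "x \<in> coset R (- t) \<longleftrightarrow> x \<in> class_neg (coset R t)"
    using add_subgroup_minus [OF assms, of "x + t"] add_subgroup_minus [OF assms, of "- (x + t)"]
    unfolding mem_class_neg coset_def mem_Collect_eq minus_minus by metis
qed

lemma class_diff_eq: "X \<ominus> Y = X \<oplus> class_neg Y"
proof (rule set_eqI)
  fix x
  have "x \<in> X \<oplus> class_neg Y \<longleftrightarrow> (\<exists>s\<in>X. \<exists>t\<in>Y. x = s + - t)"
    unfolding class_add_def class_neg_def by blast
  also have "\<dots> \<longleftrightarrow> x \<in> X \<ominus> Y"
    by (auto simp: class_diff_def)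
  finally show "x \<in> X \<ominus> Y \<longleftrightarrow> x \<in> X \<oplus> class_neg Y"
    by simp
qed

lemma coset_diff:
  assumes "add_subgroup R"
  shows "coset R (s - t) = coset R s \<ominus> coset R t"
  using coset_add [OF assms, of s "- t"] by (simp add: coset_neg [OF assms] class_diff_eq)

lemma coset_rep [simp]:
  assumes "add_subgroup R"
  shows "coset R (rep (coset R t)) = coset R t"
proof -
  have "t \<in> coset R t"
    using assms by (simp add: coset_def add_subgroup_def)
  then have "rep (coset R t) \<in> coset R t"
    unfolding rep_def by (rule someI)
  then have "rep (coset R t) - t \<in> R"
    unfolding coset_def by (rule CollectD)
  then show ?thesis
    by (rule iffD2 [OF coset_eq_iff [OF assms]])
qed

lemma frag_extend_in_subgroup:
  assumes "add_subgroup R" and "\<And>x. x \<in> Poly_Mapping.keys t \<Longrightarrow> f x \<in> R"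
  shows "frag_extend f t \<in> R"
  using subset_refl [of "Poly_Mapping.keys t"]
proof (induction t rule: frag_induction)
  case zero
  then show ?case using assms by (simp add: add_subgroup_def)
next
  case (one x)
  then show ?case using assms by simp
next
  case (diff a b)
  then show ?case using assms by (simp add: frag_extend_diff add_subgroup_def)
qed

lemma frag_extend_minus_fun:
  "frag_extend (\<lambda>x. f x - g x) t = frag_extend f t - frag_extend g t"
  using subset_UNIV [of "Poly_Mapping.keys t"]
  by (induction t rule: frag_induction) (simp_all add: frag_extend_diff)

lemma frag_extend_add_fun:
  "frag_extend (\<lambda>x. f x + g x) t = frag_extend f t + frag_extend g t"
  using subset_UNIV [of "Poly_Mapping.keys t"]
  by (induction t rule: frag_induction) (simp_all add: frag_extend_diff)

lemma frag_extend_zero_fun [simp]: "frag_extend (\<lambda>x. 0) t = 0"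
  by (simp add: frag_extend_eq_0)

lemma frag_extend_bind:
  "frag_extend f (frag_extend g t) = frag_extend (\<lambda>x. frag_extend f (g x)) t"
  using subset_UNIV [of "Poly_Mapping.keys t"]
  by (induction t rule: frag_induction) (simp_all add: frag_extend_diff)

lemma frag_extend_swap:
  "frag_extend (\<lambda>x. frag_extend (f x) t) s = frag_extend (\<lambda>y. frag_extend (\<lambda>x. f x y) s) t"
  using subset_UNIV [of "Poly_Mapping.keys s"]
  by (induction s rule: frag_induction) (simp_all add: frag_extend_diff frag_extend_minus_fun)

lemma frag_extend_frag_of [simp]: "frag_extend frag_of t = t"
  by (rule frag_expansion [symmetric])

text \<open>The second hypothesis ranges over the support of \<open>t\<close> only. This is where
  length information about the lists in a coproduct or in a chosen representative enters later
  proofs.\<close>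

lemma frag_extend_coset_cong:
  assumes "add_subgroup R"
    and "\<And>x. x \<in> Poly_Mapping.keys t \<Longrightarrow> coset R (f x) = coset R (g x)"
  shows "coset R (frag_extend f t) = coset R (frag_extend g t)"
  using assms frag_extend_in_subgroup [of R t "\<lambda>x. f x - g x"]
  by (simp add: coset_eq_iff frag_extend_minus_fun)

lemma frag_extend_group_closure:
  assumes "add_subgroup R" and "\<And>x. x \<in> S \<Longrightarrow> frag_extend f x \<in> R" and "t \<in> group_closure S"
  shows "frag_extend f t \<in> R"
  using assms(3)
  by (induction rule: group_closure.induct)
    (use assms(1,2) in \<open>auto simp: frag_extend_diff add_subgroup_def\<close>)

section \<open>Defining relations and universal properties of the tensor powers\<close>

lemma add_subgroup_hpow_rel [simp]: "add_subgroup (hpow_rel H n)"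
  by (simp add: hpow_rel_def)

lemma add_subgroup_tens_rel [simp]: "add_subgroup (tens_rel H n actM)"
  by (simp add: tens_rel_def)

lemma hpow_add:
  assumes "length hs = n" "i < n"
  shows "coset (hpow_rel H n) (frag_of (hs[i := a + b])) =
    coset (hpow_rel H n) (frag_of (hs[i := a]) + frag_of (hs[i := b]))"
  unfolding coset_eq_iff [OF add_subgroup_hpow_rel]
  unfolding hpow_rel_def diff_diff_eq [symmetric]
  by (intro group_closure.base insertI2 UnI1) (use assms in blast)

lemma hpow_scal:
  assumes "length hs = n" "i < n" "j < n"
  shows "coset (hpow_rel H n) (frag_of (hs[i := scal H c (hs ! i)])) =
    coset (hpow_rel H n) (frag_of (hs[j := scal H c (hs ! j)]))"
  unfolding coset_eq_iff [OF add_subgroup_hpow_rel]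
  unfolding hpow_rel_def
  by (intro group_closure.base insertI2 UnI2) (use assms in blast)

text \<open>Universal property of the n-th tensor power over k: a multiadditive map that allows
  scalars to move between factors descends to classes. Premises and conclusion are equations of
  cosets, so that results of this shape can be chained without returning to membership in the
  relations.\<close>

lemma hpow_rel_lift:
  assumes R: "add_subgroup R"
    and add: "\<And>hs i a b. length hs = n \<Longrightarrow> i < n \<Longrightarrow>
      coset R (f (hs[i := a + b])) = coset R (f (hs[i := a]) + f (hs[i := b]))"
    and scal: "\<And>hs i j c. length hs = n \<Longrightarrow> i < n \<Longrightarrow> j < n \<Longrightarrow>
      coset R (f (hs[i := scal H c (hs ! i)])) = coset R (f (hs[j := scal H c (hs ! j)]))"
    and eq: "coset (hpow_rel H n) s = coset (hpow_rel H n) t"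
  shows "coset R (frag_extend f s) = coset R (frag_extend f t)"
proof -
  have "frag_extend f (s - t) \<in> R"
  proof (rule frag_extend_group_closure [OF R])
    have "s - t \<in> hpow_rel H n"
      using eq by (simp add: coset_eq_iff)
    then show "s - t \<in> group_closure
     ({frag_of (hs[i := a + b]) - frag_of (hs[i := a]) - frag_of (hs[i := b])
        | hs i a b. length hs = n \<and> i < n} \<union>
      {frag_of (hs[i := scal H c (hs ! i)]) - frag_of (hs[j := scal H c (hs ! j)])
        | hs i j c. length hs = n \<and> i < n \<and> j < n})"
      by (simp add: hpow_rel_def)
  next
    fix x
    assume "x \<in> {frag_of (hs[i := a + b]) - frag_of (hs[i := a]) - frag_of (hs[i := b])
        | hs i a b. length hs = n \<and> i < n} \<union>
      {frag_of (hs[i := scal H c (hs ! i)]) - frag_of (hs[j := scal H c (hs ! j)])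
        | hs i j c. length hs = n \<and> i < n \<and> j < n}"
    then consider
      (add) hs i a b where
        "x = frag_of (hs[i := a + b]) - frag_of (hs[i := a]) - frag_of (hs[i := b])"
        "length hs = n" "i < n"
    | (scal) hs i j c where
        "x = frag_of (hs[i := scal H c (hs ! i)]) - frag_of (hs[j := scal H c (hs ! j)])"
        "length hs = n" "i < n" "j < n"
      by blast
    then show "frag_extend f x \<in> R"
    proof cases
      case add
      then show ?thesis
        using assms(2) [of hs i a b] R by (simp add: coset_eq_iff frag_extend_diff frag_extend_add diff_diff_eq)
    next
      case scal
      then show ?thesis
        using assms(3) [of hs i j c] R by (simp add: coset_eq_iff frag_extend_diff)
    qed
  qed
  then show ?thesis
    using R by (simp add: coset_eq_iff frag_extend_diff)
qed

lemma tens_hpow: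
  assumes "coset (hpow_rel H n) s = coset (hpow_rel H n) t"
  shows "coset (tens_rel H n actM) (frag_extend (\<lambda>hs. frag_of (hs, m)) s) =
    coset (tens_rel H n actM) (frag_extend (\<lambda>hs. frag_of (hs, m)) t)"
  unfolding coset_eq_iff [OF add_subgroup_tens_rel] frag_extend_diff [symmetric]
  unfolding tens_rel_def
  by (intro group_closure.base insertI2 UnI1)
    (use assms [unfolded coset_eq_iff [OF add_subgroup_hpow_rel]] in blast)

lemma tens_add:
  assumes "length hs = n"
  shows "coset (tens_rel H n actM) (frag_of (hs, m + m')) =
    coset (tens_rel H n actM) (frag_of (hs, m) + frag_of (hs, m'))"
  unfolding coset_eq_iff [OF add_subgroup_tens_rel]
  unfolding tens_rel_def diff_diff_eq [symmetric]
  by (intro group_closure.base insertI2 UnI1 [OF UnI2]) (use assms in blast)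

lemma tens_balance:
  assumes "length hs = n"
  shows "coset (tens_rel H n actM)
      (frag_extend (\<lambda>gs. frag_of (map2 (*) hs gs, m)) (coprod H n h)) =
    coset (tens_rel H n actM) (frag_of (hs, actM h m))"
  unfolding coset_eq_iff [OF add_subgroup_tens_rel]
  unfolding tens_rel_def
  by (intro group_closure.base insertI2 UnI2) (use assms in blast)

text \<open>Universal property of the tensor product over H, one premise for each of the three
  families of relations. The premise \<open>balance\<close> is the one in which the Hopf structure
  matters.\<close>

lemma tens_rel_lift:
  assumes R: "add_subgroup R"
    and hpow: "\<And>m s t. coset (hpow_rel H n) s = coset (hpow_rel H n) t \<Longrightarrow>
      coset R (frag_extend (\<lambda>hs. f (hs, m)) s) = coset R (frag_extend (\<lambda>hs. f (hs, m)) t)"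
    and add: "\<And>hs m m'. length hs = n \<Longrightarrow>
      coset R (f (hs, m + m')) = coset R (f (hs, m) + f (hs, m'))"
    and balance: "\<And>hs h m. length hs = n \<Longrightarrow>
      coset R (frag_extend (\<lambda>gs. f (map2 (*) hs gs, m)) (coprod H n h)) =
      coset R (f (hs, actM h m))"
    and eq: "coset (tens_rel H n actM) s = coset (tens_rel H n actM) t"
  shows "coset R (frag_extend f s) = coset R (frag_extend f t)"
proof -
  have "frag_extend f (s - t) \<in> R"
  proof (rule frag_extend_group_closure [OF R])
    show "s - t \<in> group_closure
     ({frag_extend (\<lambda>hs. frag_of (hs, m)) r | r m. r \<in> hpow_rel H n} \<union>
      {frag_of (hs, m + m') - frag_of (hs, m) - frag_of (hs, m') | hs m m'. length hs = n} \<union>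
      {frag_extend (\<lambda>gs. frag_of (map2 (*) hs gs, m)) (coprod H n h) - frag_of (hs, actM h m)
        | hs h m. length hs = n})"
      using eq unfolding coset_eq_iff [OF add_subgroup_tens_rel] by (simp add: tens_rel_def)
  next
    fix x
    assume "x \<in> {frag_extend (\<lambda>hs. frag_of (hs, m)) r | r m. r \<in> hpow_rel H n} \<union>
      {frag_of (hs, m + m') - frag_of (hs, m) - frag_of (hs, m') | hs m m'. length hs = n} \<union>
      {frag_extend (\<lambda>gs. frag_of (map2 (*) hs gs, m)) (coprod H n h) - frag_of (hs, actM h m)
        | hs h m. length hs = n}"
    then consider
      (hpow) r m where "x = frag_extend (\<lambda>hs. frag_of (hs, m)) r" "r \<in> hpow_rel H n"
    | (add) hs m m' where "x = frag_of (hs, m + m') - frag_of (hs, m) - frag_of (hs, m')"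
        "length hs = n"
    | (balance) hs h m where "x = frag_extend (\<lambda>gs. frag_of (map2 (*) hs gs, m)) (coprod H n h)
        - frag_of (hs, actM h m)" "length hs = n"
      by blast
    then show "frag_extend f x \<in> R"
    proof cases
      case hpow
      then show ?thesis
        using assms(2) [of r 0 m] R by (simp add: coset_eq_iff frag_extend_bind)
    next
      case add
      then show ?thesis
        using assms(3) [of hs m m'] R by (simp add: coset_eq_iff frag_extend_diff frag_extend_add diff_diff_eq)
    next
      case balance
      then show ?thesis
        using assms(4) [of hs m h] R by (simp add: coset_eq_iff frag_extend_bind frag_extend_diff)
    qed
  qed
  then show ?thesis
    using R by (simp add: coset_eq_iff frag_extend_diff)
qed

text \<open>Tensoring with fixed pure tensors on both sides descends to classes, because updating
  position i of the middle block updates position \<open>length xs + i\<close> of the whole list. It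
  transports identities for one block of factors into a longer tensor.\<close>

lemma hpow_context:
  fixes xs ys :: "'h::ring_1 list"
  assumes "coset (hpow_rel H n) s = coset (hpow_rel H n) t" and N: "N = length xs + n + length ys"
  shows "coset (hpow_rel H N) (frag_extend (\<lambda>hs. frag_of (xs @ hs @ ys)) s) =
    coset (hpow_rel H N) (frag_extend (\<lambda>hs. frag_of (xs @ hs @ ys)) t)"
proof (rule hpow_rel_lift [OF add_subgroup_hpow_rel _ _ assms(1)])
  have upd: "xs @ hs[i := a] @ ys = (xs @ hs @ ys)[length xs + i := a]"
    if "length hs = n" "i < n" for hs :: "'h list" and i a
    using that by (simp add: list_update_append)
  {
    fix hs :: "'h list" and i a b
    assume "length hs = n" "i < n"
    then show "coset (hpow_rel H N) (frag_of (xs @ hs[i := a + b] @ ys)) =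
      coset (hpow_rel H N) (frag_of (xs @ hs[i := a] @ ys) + frag_of (xs @ hs[i := b] @ ys))"
      unfolding upd [OF \<open>length hs = n\<close> \<open>i < n\<close>] using N by (intro hpow_add) auto
  }
  {
    fix hs :: "'h list" and i j c
    assume *: "length hs = n" "i < n" "j < n"
    have "hs ! i = (xs @ hs @ ys) ! (length xs + i)" "hs ! j = (xs @ hs @ ys) ! (length xs + j)"
      using * by (simp_all add: nth_append)
    then show "coset (hpow_rel H N) (frag_of (xs @ hs[i := scal H c (hs ! i)] @ ys)) =
      coset (hpow_rel H N) (frag_of (xs @ hs[j := scal H c (hs ! j)] @ ys))"
      using upd * N hpow_scal [of "xs @ hs @ ys" N "length xs + i" "length xs + j" H c]
      by simp
  }
qed

section \<open>Lists under factorwise multiplication and permutation\<close>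

lemma map2_update_right:
  "length xs = length ys \<Longrightarrow> map2 f xs (ys[i := b]) = (map2 f xs ys)[i := f (xs ! i) b]"
  by (induction xs ys arbitrary: i rule: list_induct2) (auto split: nat.split)

lemma map2_update_left:
  "length xs = length ys \<Longrightarrow> map2 f (xs[i := a]) ys = (map2 f xs ys)[i := f a (ys ! i)]"
  by (induction xs ys arbitrary: i rule: list_induct2) (auto split: nat.split)

lemma map_transpose_append:
  assumes i: "i = length xs" and n: "n = Suc (Suc (length xs + length ys))"
  shows "map (\<lambda>j. (xs @ [c, d] @ ys) ! transpose i (Suc i) j) [0..<n] = xs @ [d, c] @ ys"
proof (rule nth_equalityI)
  fix j assume "j < length (map (\<lambda>j. (xs @ [c, d] @ ys) ! transpose i (Suc i) j) [0..<n])"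
  then have j: "j < n"
    by simp
  consider "j < i" | "j = i" | "j = Suc i" | "Suc i < j"
    by linarith
  then show "map (\<lambda>j. (xs @ [c, d] @ ys) ! transpose i (Suc i) j) [0..<n] ! j = (xs @ [d, c] @ ys) ! j"
  proof cases
    case 4
    then obtain k where "j = Suc (Suc (i + k))"
      by (auto dest: less_imp_Suc_add)
    with j i show ?thesis
      by (simp add: nth_append transpose_def)
  qed (use i j n in \<open>simp_all add: nth_append transpose_def del: upt_Suc\<close>)
qed (simp add: n)

lemma keys_frag_extendE:
  assumes "x \<in> Poly_Mapping.keys (frag_extend f c)"
  obtains y where "y \<in> Poly_Mapping.keys c" "x \<in> Poly_Mapping.keys (f y)"
  using subsetD [OF keys_frag_extend assms] by blast

lemma keys_diff_subset:
  "Poly_Mapping.keys a \<subseteq> S \<Longrightarrow> Poly_Mapping.keys b \<subseteq> S \<Longrightarrow>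
    Poly_Mapping.keys (a - b :: 'a \<Rightarrow>\<^sub>0 int) \<subseteq> S"
  using keys_diff [of a b] by blast

lemma map2_mult_assoc:
  fixes a b c :: "'a::semigroup_mult list"
  shows "map2 (*) a (map2 (*) b c) = map2 (*) (map2 (*) a b) c"
  by (rule nth_equalityI) (auto simp: mult.assoc)

lemma map2_mult_ones: "length xs = n \<Longrightarrow> map2 (*) (replicate n 1) xs = (xs :: 'a::monoid_mult list)"
  by (rule nth_equalityI) auto

text \<open>Multiplying only the inserted block, as a composition does, is left multiplication of
  the whole list by \<open>hs\<close> padded with ones. This lets \<open>compose_term_cong\<close>
  split a composition into an insertion and a left multiplication.\<close>

lemma map2_mult_pad:
  fixes fs :: "'a::monoid_mult list"
  assumes "m < length fs" "length hs = length gs"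
  shows "map2 (*) (replicate m 1 @ hs @ replicate (length fs - Suc m) 1) (take m fs @ gs @ drop (Suc m) fs) =
    take m fs @ map2 (*) hs gs @ drop (Suc m) fs"
  using assms by (simp add: map2_mult_ones)

section \<open>The iterated coproduct\<close>

locale cocommutative_hopf =
  fixes H :: "('k::field, 'h::ring_1) hopf"
  assumes hopf: "cocommutative_hopf_algebra H"
begin

abbreviation hp :: "nat \<Rightarrow> ('h list \<Rightarrow>\<^sub>0 int) \<Rightarrow> ('h list \<Rightarrow>\<^sub>0 int) set" where
  "hp n \<equiv> coset (hpow_rel H n)"

lemma scal_mult: "scal H c (a * b) = scal H c a * b" "scal H c (a * b) = a * scal H c b"
  using hopf by (auto simp: cocommutative_hopf_algebra_def assoc_algebra_def)

text \<open>All generators are supported on lists of length n. Hence a representative picked by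
  \<open>rep\<close> from a class in \<open>hpow H n\<close> is supported there too, although the
  coset is formed inside the free group on all lists.\<close>

lemma keys_hpow_rel:
  assumes "r \<in> hpow_rel H n"
  shows "Poly_Mapping.keys r \<subseteq> {hs. length hs = n}"
  using assms unfolding hpow_rel_def
proof (induction rule: group_closure.induct)
  case (base s)
  have "Poly_Mapping.keys (frag_of hs - frag_of gs - frag_of ks) \<subseteq> {hs. length hs = n}"
    if "length hs = n" "length gs = n" "length ks = n" for hs gs ks :: "'h list"
    using keys_diff [of "frag_of hs - frag_of gs" "frag_of ks"]
      keys_diff [of "frag_of hs" "frag_of gs"] that by auto
  moreover have "Poly_Mapping.keys (frag_of hs - frag_of gs) \<subseteq> {hs. length hs = n}"
    if "length hs = n" "length gs = n" for hs gs :: "'h list"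
    using keys_diff [of "frag_of hs" "frag_of gs"] that by auto
  ultimately show ?case
    using base by (elim insertE UnE CollectE exE conjE; simp)
next
  case (diff s t)
  then show ?case
    using keys_diff [of s t] by blast
qed

lemma comult_in_hpow: "comult H h \<in> hpow H 2"
  using hopf by (simp add: cocommutative_hopf_algebra_def)

lemma hp_sweedler: "hp 2 (sweedler H h) = comult H h"
  using comult_in_hpow [of h] by (auto simp: hpow_def sweedler_def)

lemma length_keys_sweedler:
  assumes "ab \<in> Poly_Mapping.keys (sweedler H h)"
  shows "length ab = 2"
proof -
  obtain t where t: "comult H h = hp 2 t" "Poly_Mapping.keys t \<subseteq> {hs. length hs = 2}"
    using comult_in_hpow [of h] by (auto simp: hpow_def)
  then have "sweedler H h - t \<in> hpow_rel H 2"
    using hp_sweedler [of h] by (simp add: coset_eq_iff)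
  then have "Poly_Mapping.keys (sweedler H h - t) \<subseteq> {hs. length hs = 2}"
    by (rule keys_hpow_rel)
  then show ?thesis
    using assms t(2) keys_add [of "sweedler H h - t" t] by auto
qed

lemma sweedler_pairE:
  assumes "ab \<in> Poly_Mapping.keys (sweedler H h)"
  obtains a b where "ab = [a, b]"
  using length_keys_sweedler [OF assms] by (auto simp: length_Suc_conv numeral_2_eq_2)

lemma sweedler_add: "hp 2 (sweedler H (g + h)) = hp 2 (sweedler H g + sweedler H h)"
  using hopf by (simp add: cocommutative_hopf_algebra_def hp_sweedler coset_add)

lemma sweedler_scal:
  "hp 2 (sweedler H (scal H c h)) =
    hp 2 (frag_extend (\<lambda>ab. frag_of [scal H c (ab ! 0), ab ! 1]) (sweedler H h))"
  using hopf
  by (simp add: cocommutative_hopf_algebra_def hp_sweedler induced_def flip: sweedler_def)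

lemma sweedler_mult:
  "hp 2 (sweedler H (g * h)) =
    hp 2 (frag_extend (\<lambda>ab. frag_extend (\<lambda>cd. frag_of (map2 (*) ab cd)) (sweedler H h))
      (sweedler H g))"
  using hopf by (simp add: cocommutative_hopf_algebra_def hp_sweedler)

lemma sweedler_coassoc:
  "hp 3 (frag_extend (\<lambda>ab. frag_extend (\<lambda>cd. frag_of (cd @ [ab ! 1])) (sweedler H (ab ! 0)))
      (sweedler H h)) =
   hp 3 (frag_extend (\<lambda>ab. frag_extend (\<lambda>cd. frag_of (ab ! 0 # cd)) (sweedler H (ab ! 1)))
      (sweedler H h))"
  using hopf by (simp add: cocommutative_hopf_algebra_def)

lemma sweedler_commute:
  "hp 2 (frag_extend (\<lambda>ab. frag_of [ab ! 1, ab ! 0]) (sweedler H h)) = hp 2 (sweedler H h)"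
  using hopf
  by (simp add: cocommutative_hopf_algebra_def hp_sweedler induced_def flip: sweedler_def)

lemma length_keys_coprod:
  "hs \<in> Poly_Mapping.keys (coprod H n h) \<Longrightarrow> length hs = n"
proof (induction n arbitrary: hs h rule: induct_nat_012)
  case (ge2 n)
  from ge2(3) obtain ab where
    "hs \<in> Poly_Mapping.keys (frag_extend (\<lambda>hs. frag_of (ab ! 0 # hs)) (coprod H (Suc n) (ab ! 1)))"
    unfolding coprod.simps by (blast dest: subsetD [OF keys_frag_extend])
  then obtain gs where "gs \<in> Poly_Mapping.keys (coprod H (Suc n) (ab ! 1))"
    "hs \<in> Poly_Mapping.keys (frag_of (ab ! 0 # gs))"
    by (blast dest: subsetD [OF keys_frag_extend])
  with ge2 show ?case
    by simp
qed auto

section \<open>Applying an iterated coproduct to one tensor factor\<close>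

definition insert_coprod :: "nat \<Rightarrow> nat \<Rightarrow> 'h list \<Rightarrow> ('h list \<Rightarrow>\<^sub>0 int)" where
  "insert_coprod m l hs =
    frag_extend (\<lambda>gs. frag_of (take m hs @ gs @ drop (Suc m) hs)) (coprod H l (hs ! m))"

text \<open>The recursion reads (id \<otimes> (n+1)-fold coproduct) after \<Delta>. In this form the
  results on \<open>insert_coprod\<close> apply to the iterated coproduct itself.\<close>

lemma coprod_Suc_Suc: "coprod H (Suc (Suc n)) h = frag_extend (insert_coprod 1 (Suc n)) (sweedler H h)"
  unfolding coprod.simps
proof (rule frag_extend_eq)
  fix ab assume "ab \<in> Poly_Mapping.keys (sweedler H h)"
  then obtain a b where "ab = [a, b]"
    by (rule sweedler_pairE)
  then show "frag_extend (\<lambda>hs. frag_of (ab ! 0 # hs)) (coprod H (Suc n) (ab ! 1)) =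
      insert_coprod 1 (Suc n) ab"
    by (simp add: insert_coprod_def)
qed

text \<open>One factor is replaced by l factors, so positions to the right of \<open>m\<close> shift
  by l - 1. The subtraction is harmless because such a position is at least 1.\<close>

lemma insert_coprod_update_other:
  assumes "i \<noteq> m" "m < length hs" "i < length hs"
  shows "insert_coprod m l (hs[i := a]) =
    frag_extend (\<lambda>gs. frag_of ((take m hs @ gs @ drop (Suc m) hs)
      [(if i < m then i else i + l - 1) := a])) (coprod H l (hs ! m))"
proof -
  have "take m (hs[i := a]) @ gs @ drop (Suc m) (hs[i := a]) =
      (take m hs @ gs @ drop (Suc m) hs)[(if i < m then i else i + l - 1) := a]"
    if "length gs = l" for gs
    using assms that
    by (cases "i < m")
      (auto simp: list_update_append drop_update_swap take_update_swap Suc_diff_le min_def list_update_beyond)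
  then show ?thesis
    using assms unfolding insert_coprod_def
    by (auto intro!: frag_extend_eq dest: length_keys_coprod)
qed

text \<open>Additivity and k-linearity of the l-fold coproduct are premises here because the lemma
  serves inside the induction that proves them. \<open>insert_coprod_cong\<close> later discharges
  both.\<close>

lemma insert_coprod_lift:
  assumes l: "0 < l" and m: "m < k" and N: "N = k + l - 1"
    and add: "\<And>a b. hp l (coprod H l (a + b)) = hp l (coprod H l a + coprod H l b)"
    and scal: "\<And>c h. hp l (coprod H l (scal H c h)) =
      hp l (frag_extend (\<lambda>hs. frag_of (hs[0 := scal H c (hs ! 0)])) (coprod H l h))"
    and eq: "hp k s = hp k t"
  shows "hp N (frag_extend (insert_coprod m l) s) = hp N (frag_extend (insert_coprod m l) t)"
proof (rule hpow_rel_lift [OF add_subgroup_hpow_rel _ _ eq])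
  fix hs :: "'h list" and i a b
  assume hs: "length hs = k" and i: "i < k"
  show "hp N (insert_coprod m l (hs[i := a + b])) =
      hp N (insert_coprod m l (hs[i := a]) + insert_coprod m l (hs[i := b]))"
  proof (cases "i = m")
    case True
    have "hp N (insert_coprod m l (hs[i := a + b])) =
        hp N (frag_extend (\<lambda>gs. frag_of (take m hs @ gs @ drop (Suc m) hs))
          (coprod H l (a + b)))"
      using True hs m by (simp add: insert_coprod_def)
    also have "\<dots> = hp N (frag_extend (\<lambda>gs. frag_of (take m hs @ gs @ drop (Suc m) hs))
          (coprod H l a + coprod H l b))"
      by (rule hpow_context [OF add]) (use hs m l N in simp)
    finally show ?thesis
      using True hs m by (simp add: insert_coprod_def frag_extend_add)
  next
    case False
    let ?i = "if i < m then i else i + l - 1"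
    have "hp N (frag_extend (\<lambda>gs. frag_of ((take m hs @ gs @ drop (Suc m) hs)[?i := a + b]))
        (coprod H l (hs ! m))) =
      hp N (frag_extend (\<lambda>gs. frag_of ((take m hs @ gs @ drop (Suc m) hs)[?i := a]) +
        frag_of ((take m hs @ gs @ drop (Suc m) hs)[?i := b])) (coprod H l (hs ! m)))"
      by (intro frag_extend_coset_cong add_subgroup_hpow_rel hpow_add)
        (use False hs m i l N in \<open>auto dest!: length_keys_coprod\<close>)
    then show ?thesis
      unfolding insert_coprod_update_other [OF False m [folded hs] i [folded hs]]
        frag_extend_add_fun .
  qed
next
  fix hs :: "'h list" and i j c
  assume hs: "length hs = k" and ij: "i < k" "j < k"
  \<comment> \<open>Wherever the scalar starts, it can be moved to position \<open>m\<close>, the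
    first factor of the inserted block. The right-hand side does not mention \<open>i\<close>, so
    the cases of \<open>i\<close> and \<open>j\<close> agree.\<close>
  have *: "hp N (insert_coprod m l (hs[i := scal H c (hs ! i)])) =
      hp N (frag_extend (\<lambda>gs. frag_of ((take m hs @ gs @ drop (Suc m) hs)
        [m := scal H c ((take m hs @ gs @ drop (Suc m) hs) ! m)])) (coprod H l (hs ! m)))"
    if i: "i < k" for i
  proof (cases "i = m")
    case True
    have "hp N (insert_coprod m l (hs[i := scal H c (hs ! i)])) =
        hp N (frag_extend (\<lambda>gs. frag_of (take m hs @ gs @ drop (Suc m) hs))
          (coprod H l (scal H c (hs ! m))))"
      using True hs m by (simp add: insert_coprod_def)
    also have "\<dots> = hp N (frag_extend (\<lambda>gs. frag_of (take m hs @ gs @ drop (Suc m) hs))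
          (frag_extend (\<lambda>hs. frag_of (hs[0 := scal H c (hs ! 0)])) (coprod H l (hs ! m))))"
      by (rule hpow_context [OF scal]) (use hs m l N in simp)
    also have "\<dots> = hp N (frag_extend (\<lambda>gs. frag_of ((take m hs @ gs @ drop (Suc m) hs)
        [m := scal H c ((take m hs @ gs @ drop (Suc m) hs) ! m)])) (coprod H l (hs ! m)))"
      unfolding frag_extend_bind frag_extend_of using hs m l
      by (intro arg_cong [where f = "hp N"] frag_extend_eq)
        (auto dest!: length_keys_coprod simp: list_update_append nth_append)
    finally show ?thesis .
  next
    case False
    let ?i = "if i < m then i else i + l - 1"
    have nth: "(take m hs @ gs @ drop (Suc m) hs) ! ?i = hs ! i" if "length gs = l" for gs
      using False hs m i l that by (auto simp: nth_append)
    show ?thesis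
      unfolding insert_coprod_update_other [OF False m [folded hs] i [folded hs]]
    proof (rule frag_extend_coset_cong [OF add_subgroup_hpow_rel])
      fix gs assume "gs \<in> Poly_Mapping.keys (coprod H l (hs ! m))"
      then have gs: "length gs = l"
        by (rule length_keys_coprod)
      show "hp N (frag_of ((take m hs @ gs @ drop (Suc m) hs)[?i := scal H c (hs ! i)])) =
        hp N (frag_of ((take m hs @ gs @ drop (Suc m) hs)
          [m := scal H c ((take m hs @ gs @ drop (Suc m) hs) ! m)]))"
        unfolding nth [OF gs, symmetric]
        by (rule hpow_scal) (use False hs m i l gs N in auto)
    qed
  qed
  show "hp N (insert_coprod m l (hs[i := scal H c (hs ! i)])) =
      hp N (insert_coprod m l (hs[j := scal H c (hs ! j)]))"
    using * ij by simp
qed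

text \<open>The two claims are proved together, since descending the insertion to classes in the
  induction step uses both for the smaller coproduct.\<close>

lemma coprod_add_scal:
  "hp (Suc n) (coprod H (Suc n) (a + b)) = hp (Suc n) (coprod H (Suc n) a + coprod H (Suc n) b)
  \<and> hp (Suc n) (coprod H (Suc n) (scal H c h)) =
    hp (Suc n) (frag_extend (\<lambda>hs. frag_of (hs[0 := scal H c (hs ! 0)])) (coprod H (Suc n) h))"
proof (induction n arbitrary: a b c h)
  case 0
  have "hp (Suc 0) (frag_of ([a][0 := a + b])) = hp (Suc 0) (frag_of ([a][0 := a]) + frag_of ([a][0 := b]))"
    by (rule hpow_add) auto
  then show ?case
    by simp
next
  case (Suc n)
  note lift = insert_coprod_lift [where m = 1 and k = 2 and l = "Suc n" and N = "Suc (Suc n)",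
      OF _ _ _ conjunct1 [OF Suc.IH] conjunct2 [OF Suc.IH], simplified]
  \<comment> \<open>The coproduct is inserted at factor 1, so a scalar on factor 0 passes through
    unchanged.\<close>
  have scal: "insert_coprod 1 (Suc n) [scal H c (ab ! 0), ab ! 1] =
      frag_extend (\<lambda>hs. frag_of (hs[0 := scal H c (hs ! 0)])) (insert_coprod 1 (Suc n) ab)"
    if ab: "ab \<in> Poly_Mapping.keys (sweedler H h)" for ab
  proof -
    obtain a b where "ab = [a, b]"
      by (rule sweedler_pairE [OF ab])
    then show ?thesis
      by (simp add: insert_coprod_def frag_extend_bind)
  qed
  show ?case
    unfolding coprod_Suc_Suc
  proof
    show "hp (Suc (Suc n)) (frag_extend (insert_coprod 1 (Suc n)) (sweedler H (a + b))) =
        hp (Suc (Suc n)) (frag_extend (insert_coprod 1 (Suc n)) (sweedler H a) +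
          frag_extend (insert_coprod 1 (Suc n)) (sweedler H b))"
      using lift [OF sweedler_add] by (simp add: frag_extend_add)
    show "hp (Suc (Suc n)) (frag_extend (insert_coprod 1 (Suc n)) (sweedler H (scal H c h))) =
        hp (Suc (Suc n)) (frag_extend (\<lambda>hs. frag_of (hs[0 := scal H c (hs ! 0)]))
          (frag_extend (insert_coprod 1 (Suc n)) (sweedler H h)))"
      using lift [OF sweedler_scal] scal by (simp add: frag_extend_bind cong: frag_extend_eq)
  qed
qed

lemma coprod_add: "0 < n \<Longrightarrow> hp n (coprod H n (a + b)) = hp n (coprod H n a + coprod H n b)"
  using coprod_add_scal by (cases n) auto

lemma coprod_scal:
  "0 < n \<Longrightarrow> hp n (coprod H n (scal H c h)) =
    hp n (frag_extend (\<lambda>hs. frag_of (hs[0 := scal H c (hs ! 0)])) (coprod H n h))"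
  using coprod_add_scal by (cases n) auto

lemma insert_coprod_cong:
  assumes "0 < l" "m < k" "N = k + l - 1" "hp k s = hp k t"
  shows "hp N (frag_extend (insert_coprod m l) s) = hp N (frag_extend (insert_coprod m l) t)"
  by (rule insert_coprod_lift [OF assms(1-3) coprod_add coprod_scal assms(4)]) (use assms in auto)

lemma coprod_2: "coprod H 2 h = sweedler H h"
  unfolding numeral_2_eq_2 coprod_Suc_Suc
proof -
  have "insert_coprod 1 (Suc 0) ab = frag_of ab" if "ab \<in> Poly_Mapping.keys (sweedler H h)" for ab
    using length_keys_sweedler [OF that]
    by (auto simp: insert_coprod_def length_Suc_conv numeral_2_eq_2)
  then show "frag_extend (insert_coprod 1 (Suc 0)) (sweedler H h) = sweedler H h"
    by (simp cong: frag_extend_eq)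
qed

section \<open>Multiplicativity of the iterated coproduct\<close>

lemma hpow_mult_left:
  assumes xs: "length xs = n" and eq: "hp n s = hp n t"
  shows "hp n (frag_extend (\<lambda>ys. frag_of (map2 (*) xs ys)) s) =
    hp n (frag_extend (\<lambda>ys. frag_of (map2 (*) xs ys)) t)"
proof (rule hpow_rel_lift [OF add_subgroup_hpow_rel _ _ eq])
  fix hs :: "'h list" and i a b
  assume "length hs = n" "i < n"
  with xs show "hp n (frag_of (map2 (*) xs (hs[i := a + b]))) =
      hp n (frag_of (map2 (*) xs (hs[i := a])) + frag_of (map2 (*) xs (hs[i := b])))"
    by (simp only: map2_update_right distrib_left) (rule hpow_add, simp_all)
next
  fix hs :: "'h list" and i j c
  assume *: "length hs = n" "i < n" "j < n"
  with xs have "xs ! i * scal H c (hs ! i) = scal H c (map2 (*) xs hs ! i)" if "i < n" for i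
    using that by (simp add: scal_mult(2))
  with * xs show "hp n (frag_of (map2 (*) xs (hs[i := scal H c (hs ! i)]))) =
      hp n (frag_of (map2 (*) xs (hs[j := scal H c (hs ! j)])))"
    by (simp only: map2_update_right) (rule hpow_scal, simp_all)
qed

lemma hpow_mult_right:
  assumes ys: "length ys = n" and eq: "hp n s = hp n t"
  shows "hp n (frag_extend (\<lambda>xs. frag_of (map2 (*) xs ys)) s) =
    hp n (frag_extend (\<lambda>xs. frag_of (map2 (*) xs ys)) t)"
proof (rule hpow_rel_lift [OF add_subgroup_hpow_rel _ _ eq])
  fix hs :: "'h list" and i a b
  assume "length hs = n" "i < n"
  with ys show "hp n (frag_of (map2 (*) (hs[i := a + b]) ys)) =
      hp n (frag_of (map2 (*) (hs[i := a]) ys) + frag_of (map2 (*) (hs[i := b]) ys))"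
    by (simp only: map2_update_left distrib_right) (rule hpow_add, simp_all)
next
  fix hs :: "'h list" and i j c
  assume *: "length hs = n" "i < n" "j < n"
  with ys have "scal H c (hs ! i) * ys ! i = scal H c (map2 (*) hs ys ! i)" if "i < n" for i
    using that by (simp add: scal_mult(1))
  with * ys show "hp n (frag_of (map2 (*) (hs[i := scal H c (hs ! i)]) ys)) =
      hp n (frag_of (map2 (*) (hs[j := scal H c (hs ! j)]) ys))"
    by (simp only: map2_update_left) (rule hpow_scal, simp_all)
qed

text \<open>Multiplicativity of \<Delta> splits the product into first and second components. The
  induction hypothesis handles the second components, with the product of the first ones as context.
  Exchanging the two middle sums then gives the product of the two coproducts.\<close>

lemma coprod_mult_Suc:
  "hp (Suc n) (coprod H (Suc n) (g * h)) =
    hp (Suc n) (frag_extend (\<lambda>xs. frag_extend (\<lambda>ys. frag_of (map2 (*) xs ys))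
      (coprod H (Suc n) h)) (coprod H (Suc n) g))"
proof (induction n arbitrary: g h)
  case 0
  show ?case by simp
next
  case (Suc n)
  let ?N = "Suc (Suc n)"
  have "hp ?N (coprod H ?N (g * h)) = hp ?N (frag_extend (insert_coprod 1 (Suc n))
      (frag_extend (\<lambda>ab. frag_extend (\<lambda>cd. frag_of (map2 (*) ab cd)) (sweedler H h))
        (sweedler H g)))"
    unfolding coprod_Suc_Suc by (rule insert_coprod_cong [OF _ _ _ sweedler_mult]) auto
  also have "\<dots> = hp ?N (frag_extend (\<lambda>ab. frag_extend (\<lambda>cd. insert_coprod 1 (Suc n) (map2 (*) ab cd))
      (sweedler H h)) (sweedler H g))"
    by (simp add: frag_extend_bind)
  also have "\<dots> = hp ?N (frag_extend (\<lambda>ab. frag_extend (\<lambda>cd.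
        frag_extend (\<lambda>xs. frag_extend (\<lambda>ys. frag_of (map2 (*) (ab ! 0 # xs) (cd ! 0 # ys)))
          (coprod H (Suc n) (cd ! 1))) (coprod H (Suc n) (ab ! 1)))
      (sweedler H h)) (sweedler H g))"
  proof (intro frag_extend_coset_cong add_subgroup_hpow_rel)
    fix ab cd
    assume ab: "ab \<in> Poly_Mapping.keys (sweedler H g)" and cd: "cd \<in> Poly_Mapping.keys (sweedler H h)"
    obtain a b where ab: "ab = [a, b]" by (rule sweedler_pairE [OF ab])
    obtain c d where cd: "cd = [c, d]" by (rule sweedler_pairE [OF cd])
    show "hp ?N (insert_coprod 1 (Suc n) (map2 (*) ab cd)) =
        hp ?N (frag_extend (\<lambda>xs. frag_extend (\<lambda>ys. frag_of (map2 (*) (ab ! 0 # xs) (cd ! 0 # ys)))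
          (coprod H (Suc n) (cd ! 1))) (coprod H (Suc n) (ab ! 1)))"
      using hpow_context [OF Suc.IH [of b d], of ?N "[a * c]" "[]"]
      by (simp add: ab cd insert_coprod_def frag_extend_bind)
  qed
  also have "\<dots> = hp ?N (frag_extend (\<lambda>xs. frag_extend (\<lambda>ys. frag_of (map2 (*) xs ys))
      (coprod H ?N h)) (coprod H ?N g))"
    unfolding coprod.simps frag_extend_bind frag_extend_of
    by (subst frag_extend_swap) (rule refl)
  finally show ?case .
qed

lemma coprod_mult:
  "0 < n \<Longrightarrow> hp n (coprod H n (g * h)) =
    hp n (frag_extend (\<lambda>xs. frag_extend (\<lambda>ys. frag_of (map2 (*) xs ys)) (coprod H n h))
      (coprod H n g))"
  using coprod_mult_Suc by (cases n) auto

section \<open>Coassociativity of the iterated coproduct\<close>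

lemma coprod_append:
  assumes k: "0 < k"
  shows "hp (Suc l + k) (frag_extend (\<lambda>ab. frag_extend (\<lambda>xs. frag_extend (\<lambda>ys. frag_of (xs @ ys))
      (coprod H k (ab ! 1))) (coprod H (Suc l) (ab ! 0))) (sweedler H h)) =
    hp (Suc l + k) (coprod H (Suc l + k) h)"
proof (induction l arbitrary: h)
  case 0
  obtain k' where "k = Suc k'"
    using k gr0_conv_Suc by auto
  then show ?case by simp
next
  case (Suc l)
  let ?N = "Suc (Suc l) + k"
  \<comment> \<open>This is id \<otimes> (l+1)-fold coproduct \<otimes> k-fold coproduct on three
    factors; after the first insertion the third factor sits at position l+2. Applied to the two
    sides of coassociativity, \<open>?E\<close> gives the claim for l+1 on one side. On the other
    side it puts the claim for l behind a fixed first factor, where the induction hypothesis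
    applies.\<close>
  let ?E = "\<lambda>zs. frag_extend (insert_coprod (Suc (Suc l)) k) (insert_coprod 1 (Suc l) zs)"
  have E: "?E [x, y, z] = frag_extend (\<lambda>xs. frag_extend (\<lambda>ys. frag_of (x # xs @ ys))
      (coprod H k z)) (coprod H (Suc l) y)" for x y z
  proof -
    have "frag_extend (\<lambda>xs. insert_coprod (Suc (Suc l)) k ([x] @ xs @ [z])) (coprod H (Suc l) y) =
      frag_extend (\<lambda>xs. frag_extend (\<lambda>ys. frag_of (x # xs @ ys)) (coprod H k z)) (coprod H (Suc l) y)"
    proof (rule frag_extend_eq)
      fix xs assume "xs \<in> Poly_Mapping.keys (coprod H (Suc l) y)"
      then have "length xs = Suc l" by (rule length_keys_coprod)
      then show "insert_coprod (Suc (Suc l)) k ([x] @ xs @ [z]) =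
          frag_extend (\<lambda>ys. frag_of (x # xs @ ys)) (coprod H k z)"
        by (simp add: insert_coprod_def nth_append)
    qed
    moreover have "insert_coprod 1 (Suc l) [x, y, z] =
        frag_extend (\<lambda>xs. frag_of ([x] @ xs @ [z])) (coprod H (Suc l) y)"
      by (simp add: insert_coprod_def)
    ultimately show ?thesis
      by (simp only: frag_extend_bind frag_extend_of)
  qed
  have cong: "hp ?N (frag_extend ?E s) = hp ?N (frag_extend ?E t)" if st: "hp 3 s = hp 3 t" for s t
  proof -
    have "hp (3 + l) (frag_extend (insert_coprod 1 (Suc l)) s) =
        hp (3 + l) (frag_extend (insert_coprod 1 (Suc l)) t)"
      by (rule insert_coprod_cong [OF _ _ _ st]) auto
    from insert_coprod_cong [OF k _ _ this, of "Suc (Suc l)" ?N] show ?thesis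
      by (simp add: frag_extend_bind)
  qed
  have "hp ?N (frag_extend (\<lambda>ab. frag_extend (\<lambda>xs. frag_extend (\<lambda>ys. frag_of (xs @ ys))
      (coprod H k (ab ! 1))) (coprod H (Suc (Suc l)) (ab ! 0))) (sweedler H h)) =
    hp ?N (frag_extend (\<lambda>ab. frag_extend (\<lambda>cd. ?E (cd @ [ab ! 1])) (sweedler H (ab ! 0)))
      (sweedler H h))"
  proof (intro arg_cong [where f = "hp ?N"] frag_extend_eq)
    fix ab
    show "frag_extend (\<lambda>xs. frag_extend (\<lambda>ys. frag_of (xs @ ys)) (coprod H k (ab ! 1)))
        (coprod H (Suc (Suc l)) (ab ! 0)) =
      frag_extend (\<lambda>cd. ?E (cd @ [ab ! 1])) (sweedler H (ab ! 0))"
      unfolding coprod.simps frag_extend_bind frag_extend_of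
    proof (rule frag_extend_eq)
      fix cd assume "cd \<in> Poly_Mapping.keys (sweedler H (ab ! 0))"
      then obtain c d where "cd = [c, d]" by (rule sweedler_pairE)
      then show "frag_extend (\<lambda>xs. frag_extend (\<lambda>ys. frag_of ((cd ! 0 # xs) @ ys)) (coprod H k (ab ! 1)))
          (coprod H (Suc l) (cd ! 1)) = ?E (cd @ [ab ! 1])"
        using E [of c d "ab ! 1"] by simp
    qed
  qed
  also have "\<dots> = hp ?N (frag_extend (\<lambda>ab. frag_extend (\<lambda>cd. ?E (ab ! 0 # cd)) (sweedler H (ab ! 1)))
      (sweedler H h))"
    using cong [OF sweedler_coassoc [of h]] unfolding frag_extend_bind frag_extend_of .
  also have "\<dots> = hp ?N (frag_extend (\<lambda>ab. frag_extend (\<lambda>zs. frag_of (ab ! 0 # zs))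
      (coprod H (Suc l + k) (ab ! 1))) (sweedler H h))"
  proof (intro frag_extend_coset_cong add_subgroup_hpow_rel)
    fix ab
    have "frag_extend (\<lambda>cd. ?E (ab ! 0 # cd)) (sweedler H (ab ! 1)) =
      frag_extend (\<lambda>zs. frag_of (ab ! 0 # zs)) (frag_extend (\<lambda>ab. frag_extend (\<lambda>xs.
        frag_extend (\<lambda>ys. frag_of (xs @ ys)) (coprod H k (ab ! 1)))
        (coprod H (Suc l) (ab ! 0))) (sweedler H (ab ! 1)))"
      unfolding frag_extend_bind [of _ _ "sweedler H (ab ! 1)"]
    proof (rule frag_extend_eq)
      fix cd assume "cd \<in> Poly_Mapping.keys (sweedler H (ab ! 1))"
      then obtain c d where "cd = [c, d]" by (rule sweedler_pairE)
      then show "?E (ab ! 0 # cd) = frag_extend (\<lambda>zs. frag_of (ab ! 0 # zs))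
          (frag_extend (\<lambda>xs. frag_extend (\<lambda>ys. frag_of (xs @ ys)) (coprod H k (cd ! 1)))
            (coprod H (Suc l) (cd ! 0)))"
        using E [of "ab ! 0" c d] by (simp add: frag_extend_bind)
    qed
    then show "hp ?N (frag_extend (\<lambda>cd. ?E (ab ! 0 # cd)) (sweedler H (ab ! 1))) =
      hp ?N (frag_extend (\<lambda>zs. frag_of (ab ! 0 # zs)) (coprod H (Suc l + k) (ab ! 1)))"
      using hpow_context [OF Suc.IH [of "ab ! 1"], of ?N "[ab ! 0]" "[]"] by simp
  qed
  finally show ?case
    by simp
qed

lemma insert_coprod_Cons_Suc:
  "insert_coprod (Suc m) l (a # ys) = frag_extend (\<lambda>zs. frag_of (a # zs)) (insert_coprod m l ys)"
  by (simp add: insert_coprod_def frag_extend_bind)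

text \<open>General coassociativity: every way of refining a factor gives the same iterated
  coproduct. At factor 0 this is \<open>coprod_append\<close>; otherwise the first factor is peeled
  off and the induction acts on the rest.\<close>

lemma insert_coprod_coprod:
  assumes l: "0 < l" and "m < k" and "N = k + l - 1"
  shows "hp N (frag_extend (insert_coprod m l) (coprod H k h)) = hp N (coprod H N h)"
  using assms(2,3)
proof (induction m arbitrary: k N h)
  case 0
  then consider "k = 1" | k' where "k = Suc (Suc k')"
    by (metis One_nat_def gr0_conv_Suc not0_implies_Suc)
  then show ?case
  proof cases
    case 1
    then show ?thesis
      using 0 by (simp add: insert_coprod_def)
  next
    case 2
    obtain l' where l': "l = Suc l'"
      using l gr0_conv_Suc by auto
    have N: "N = Suc l' + Suc k'"
      using 0 2 l' by simp
    have "frag_extend (insert_coprod 0 l) (coprod H k h) = frag_extend (\<lambda>ab.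
        frag_extend (\<lambda>ys. frag_extend (\<lambda>xs. frag_of (xs @ ys)) (coprod H l (ab ! 0)))
        (coprod H (Suc k') (ab ! 1))) (sweedler H h)"
      by (simp add: 2 frag_extend_bind insert_coprod_def)
    also have "\<dots> = frag_extend (\<lambda>ab.
        frag_extend (\<lambda>xs. frag_extend (\<lambda>ys. frag_of (xs @ ys)) (coprod H (Suc k') (ab ! 1)))
        (coprod H l (ab ! 0))) (sweedler H h)"
      by (subst frag_extend_swap) (rule refl)
    finally show ?thesis
      using coprod_append [of "Suc k'" l' h] by (simp add: l' N)
  qed
next
  case (Suc m)
  then obtain k' where k: "k = Suc (Suc k')"
    by (metis Suc_lessE less_imp_Suc_add)
  obtain l' where l': "l = Suc l'"
    using l gr0_conv_Suc by auto
  have N: "N = Suc (Suc (k' + l'))"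
    using Suc.prems k l' by simp
  have "hp N (frag_extend (insert_coprod (Suc m) l) (coprod H k h)) = hp N (frag_extend (\<lambda>ab.
      frag_extend (\<lambda>zs. frag_of (ab ! 0 # zs))
        (frag_extend (insert_coprod m l) (coprod H (Suc k') (ab ! 1)))) (sweedler H h))"
    by (simp add: k frag_extend_bind insert_coprod_Cons_Suc)
  also have "\<dots> = hp N (frag_extend (\<lambda>ab. frag_extend (\<lambda>zs. frag_of (ab ! 0 # zs))
        (coprod H (Suc (k' + l')) (ab ! 1))) (sweedler H h))"
  proof (rule frag_extend_coset_cong [OF add_subgroup_hpow_rel])
    fix ab
    have "hp (Suc (k' + l')) (frag_extend (insert_coprod m l) (coprod H (Suc k') (ab ! 1))) =
        hp (Suc (k' + l')) (coprod H (Suc (k' + l')) (ab ! 1))"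
      by (rule Suc.IH) (use Suc.prems k l' in auto)
    from hpow_context [OF this, of N "[ab ! 0]" "[]"]
    show "hp N (frag_extend (\<lambda>zs. frag_of (ab ! 0 # zs))
        (frag_extend (insert_coprod m l) (coprod H (Suc k') (ab ! 1)))) =
      hp N (frag_extend (\<lambda>zs. frag_of (ab ! 0 # zs)) (coprod H (Suc (k' + l')) (ab ! 1)))"
      by (simp add: N)
  qed
  finally show ?case
    by (simp add: N)
qed

section \<open>Permutation invariance of the iterated coproduct\<close>

lemma hpow_perm:
  assumes ps: "length ps = n" "set ps = {..<n}" and eq: "hp n s = hp n t"
  shows "hp n (frag_extend (\<lambda>hs. frag_of (map ((!) hs) ps)) s) =
    hp n (frag_extend (\<lambda>hs. frag_of (map ((!) hs) ps)) t)"
proof -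
  have dist: "distinct ps"
    using ps by (intro card_distinct) simp
  have "\<exists>i'<n. ps ! i' = i" if "i < n" for i
    using ps that by (metis in_set_conv_nth lessThan_iff)
  \<comment> \<open>\<open>q\<close> inverts \<open>ps\<close>: factor i of the argument lands at
    position \<open>q i\<close> of the result. An update at i thus becomes an update at
    \<open>q i\<close>.\<close>
  then obtain q where q: "\<And>i. i < n \<Longrightarrow> q i < n" "\<And>i. i < n \<Longrightarrow> ps ! q i = i"
    by metis
  have upd: "map ((!) (hs[i := a])) ps = (map ((!) hs) ps)[q i := a]"
    if hs: "length hs = n" and i: "i < n" for hs :: "'h list" and i a
  proof (rule nth_equalityI)
    fix j assume "j < length (map ((!) (hs[i := a])) ps)"
    then have j: "j < n"
      using ps by simp
    show "map ((!) (hs[i := a])) ps ! j = (map ((!) hs) ps)[q i := a] ! j"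
    proof (cases "j = q i")
      case True
      then show ?thesis
        using j ps(1) q(2) [OF i] hs i by simp
    next
      case False
      then have "ps ! j \<noteq> i"
        using q [OF i] dist ps(1) j by (metis nth_eq_iff_index_eq)
      then show ?thesis
        using j ps(1) False by simp
    qed
  qed simp
  show ?thesis
  proof (rule hpow_rel_lift [OF add_subgroup_hpow_rel _ _ eq])
    fix hs :: "'h list" and i a b
    assume hs: "length hs = n" and i: "i < n"
    show "hp n (frag_of (map ((!) (hs[i := a + b])) ps)) =
        hp n (frag_of (map ((!) (hs[i := a])) ps) + frag_of (map ((!) (hs[i := b])) ps))"
      unfolding upd [OF hs i] by (rule hpow_add) (use ps q i in simp_all)
  next
    fix hs :: "'h list" and i j c
    assume hs: "length hs = n" and i: "i < n" and j: "j < n"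
    have nth: "hs ! i = map ((!) hs) ps ! q i" if "i < n" for i
      using q [OF that] ps(1) by simp
    show "hp n (frag_of (map ((!) (hs[i := scal H c (hs ! i)])) ps)) =
        hp n (frag_of (map ((!) (hs[j := scal H c (hs ! j)])) ps))"
      unfolding upd [OF hs i] upd [OF hs j] nth [OF i] nth [OF j]
      by (rule hpow_scal) (use ps q i j in simp_all)
  qed
qed

text \<open>By coassociativity the n-fold coproduct is \<Delta> applied to factor i of the
  (n-1)-fold one. The factors i and i+1 are then the two components of one \<Delta>, which
  cocommutativity exchanges.\<close>

lemma coprod_adjacent_transpose:
  assumes i: "Suc i < n"
  shows "hp n (frag_extend (\<lambda>hs. frag_of (map (\<lambda>j. hs ! transpose i (Suc i) j) [0..<n])) (coprod H n h)) =
    hp n (coprod H n h)"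
proof -
  let ?p = "\<lambda>hs :: 'h list. map (\<lambda>j. hs ! transpose i (Suc i) j) [0..<n]"
  let ?ps = "map (transpose i (Suc i)) [0..<n]"
  have ps: "length ?ps = n" "set ?ps = {..<n}"
    using permutes_image [OF permutes_swap_id [of i "{..<n}" "Suc i"]] i
    by (auto simp: lessThan_atLeast0)
  have p: "?p hs = map ((!) hs) ?ps" for hs
    by simp
  have n: "n = (n - 1) + 2 - 1" "i < n - 1"
    using i by simp_all
  note ins = insert_coprod_coprod [OF _ n(2,1), of h, simplified]
  have swap: "?p (take i hs @ gs @ drop (Suc i) hs) = take i hs @ [gs ! 1, gs ! 0] @ drop (Suc i) hs"
    if hs: "length hs = n - 1" and gs: "gs \<in> Poly_Mapping.keys (sweedler H a)" for hs gs a
  proof -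
    obtain c d where cd: "gs = [c, d]" by (rule sweedler_pairE [OF gs])
    have "i = length (take i hs)" "n = Suc (Suc (length (take i hs) + length (drop (Suc i) hs)))"
      using hs i by simp_all
    from map_transpose_append [OF this, of c d] show ?thesis
      by (simp only: cd nth_Cons_0 nth_Cons_Suc One_nat_def)
  qed
  have "hp n (frag_extend (\<lambda>hs. frag_of (?p hs)) (coprod H n h)) =
      hp n (frag_extend (\<lambda>hs. frag_of (?p hs)) (frag_extend (insert_coprod i 2) (coprod H (n - 1) h)))"
    unfolding p by (rule hpow_perm [OF ps]) (simp add: ins)
  also have "\<dots> = hp n (frag_extend (\<lambda>hs. frag_extend (\<lambda>gs.
      frag_of (take i hs @ [gs ! 1, gs ! 0] @ drop (Suc i) hs)) (sweedler H (hs ! i)))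
      (coprod H (n - 1) h))"
    unfolding frag_extend_bind insert_coprod_def frag_extend_of coprod_2
    by (intro arg_cong [where f = "hp n"] frag_extend_eq)
      (simp only: swap length_keys_coprod)
  also have "\<dots> = hp n (frag_extend (insert_coprod i 2) (coprod H (n - 1) h))"
  proof (rule frag_extend_coset_cong [OF add_subgroup_hpow_rel])
    fix hs assume "hs \<in> Poly_Mapping.keys (coprod H (n - 1) h)"
    then have "length hs = n - 1" by (rule length_keys_coprod)
    then show "hp n (frag_extend (\<lambda>gs. frag_of (take i hs @ [gs ! 1, gs ! 0] @ drop (Suc i) hs))
        (sweedler H (hs ! i))) = hp n (insert_coprod i 2 hs)"
      using hpow_context [OF sweedler_commute [of "hs ! i"], of n "take i hs" "drop (Suc i) hs"] i
      by (simp add: insert_coprod_def coprod_2 frag_extend_bind)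
  qed
  finally show ?thesis
    by (simp add: ins)
qed

text \<open>Adjacent transpositions generate all permutations, and the permutations that fix the
  coproduct are closed under composition. This is what makes \<open>reorder\<close> well
  defined.\<close>

lemma coprod_perm:
  assumes ps: "length ps = n" "set ps = {..<n}"
  shows "hp n (frag_extend (\<lambda>hs. frag_of (map ((!) hs) ps)) (coprod H n h)) = hp n (coprod H n h)"
proof -
  define Q where "Q f \<longleftrightarrow> (\<forall>h. hp n (frag_extend (\<lambda>hs. frag_of (map (\<lambda>j. hs ! f j) [0..<n]))
    (coprod H n h)) = hp n (coprod H n h))" for f :: "nat \<Rightarrow> nat"
  have Q_comp: "Q (f \<circ> g)" if "Q f" "Q g" and g: "g permutes {..<n}" for f g
    unfolding Q_def
  proof
    fix h
    have set_g: "set (map g [0..<n]) = {..<n}"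
      using permutes_image [OF g] by (auto simp: lessThan_atLeast0)
    have eq: "map (\<lambda>j. hs ! (f \<circ> g) j) [0..<n] = map ((!) (map (\<lambda>j. hs ! f j) [0..<n])) (map g [0..<n])"
      for hs :: "'h list"
      using permutes_in_image [OF g] by simp
    have "hp n (frag_extend (\<lambda>hs. frag_of (map (\<lambda>j. hs ! (f \<circ> g) j) [0..<n])) (coprod H n h)) =
        hp n (frag_extend (\<lambda>hs. frag_of (map ((!) hs) (map g [0..<n])))
          (frag_extend (\<lambda>hs. frag_of (map (\<lambda>j. hs ! f j) [0..<n])) (coprod H n h)))"
      unfolding eq frag_extend_bind frag_extend_of ..
    also have "\<dots> = hp n (frag_extend (\<lambda>hs. frag_of (map ((!) hs) (map g [0..<n]))) (coprod H n h))"
      by (rule hpow_perm [OF _ set_g]) (use \<open>Q f\<close> in \<open>simp_all add: Q_def\<close>)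
    also have "\<dots> = hp n (coprod H n h)"
      using \<open>Q g\<close> by (simp add: Q_def comp_def)
    finally show "hp n (frag_extend (\<lambda>hs. frag_of (map (\<lambda>j. hs ! (f \<circ> g) j) [0..<n])) (coprod H n h)) =
        hp n (coprod H n h)" .
  qed
  \<comment> \<open>With j = j' + 1, the transposition of i and j is the transposition of i and j'
    conjugated by the adjacent one of j' and j.\<close>
  have Q_transpose_less: "Q (transpose i j)" if "i < j" "j < n" for i j
    using that
  proof (induction j rule: less_induct)
    case (less j)
    then obtain j' where j': "j = Suc j'"
      by (cases j) auto
    show ?case
    proof (cases "i = j'")
      case True
      then show ?thesis
        using less.prems coprod_adjacent_transpose by (simp add: Q_def j')
    next
      case False
      then have *: "i < j'" "j' < n"
        using less.prems j' by auto
      have "transpose j j' \<circ> transpose j' i \<circ> transpose j j' = transpose j i"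
        by (rule transpose_comp_triple) (use * less.prems in simp_all)
      then have "transpose i j = transpose j' j \<circ> (transpose i j' \<circ> transpose j' j)"
        by (simp only: transpose_commute [of j i] transpose_commute [of j j']
            transpose_commute [of j' i] o_assoc)
      moreover have Q: "Q (transpose j' j)"
        using less.prems coprod_adjacent_transpose by (simp add: Q_def j')
      moreover have "Q (transpose i j')"
        using less.IH [of j'] * j' by simp
      moreover have perm: "transpose j' j permutes {..<n}" "transpose i j' permutes {..<n}"
        using less.prems * by (auto intro!: permutes_swap_id)
      ultimately show ?thesis
        using Q_comp [OF Q Q_comp [OF _ Q perm(1)] permutes_compose [OF perm]] by (simp only:)
    qed
  qed
  have Q_perm: "Q f" if "f permutes {..<n}" for f
    using that finite_lessThan
  proof (induction rule: permutes_induct)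
    case id
    have "frag_extend (\<lambda>hs. frag_of (map (\<lambda>j. hs ! id j) [0..<n])) (coprod H n h) =
        frag_extend frag_of (coprod H n h)" for h
    proof (rule frag_extend_eq)
      fix hs assume "hs \<in> Poly_Mapping.keys (coprod H n h)"
      then have "n = length hs" by (rule length_keys_coprod [symmetric])
      then show "frag_of (map (\<lambda>j. hs ! id j) [0..<n]) = frag_of hs"
        by (simp only: id_apply map_nth)
    qed
    then show ?case
      by (simp add: Q_def)
  next
    case (swap a b f)
    then consider "a < b" "b < n" | "b < a" "a < n"
      by fastforce
    then have "Q (transpose a b)"
      by cases (use Q_transpose_less [of a b] Q_transpose_less [of b a] in
          \<open>simp_all only: transpose_commute [of b a]\<close>)
    then show ?case
      by (rule Q_comp) (fact swap)+
  qed
  \<comment> \<open>The list is extended by the identity beyond n, since \<open>permutes\<close>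
    speaks of functions on all natural numbers.\<close>
  define f where "f i = (if i < n then ps ! i else i)" for i
  have "distinct ps"
    using ps by (intro card_distinct) simp
  then have "bij_betw ((!) ps) {..<n} {..<n}"
    by (rule bij_betw_nth) (simp_all only: ps)
  moreover have "bij_betw f {..<n} {..<n} \<longleftrightarrow> bij_betw ((!) ps) {..<n} {..<n}"
    by (rule bij_betw_cong) (simp add: f_def)
  ultimately have "bij_betw f {..<n} {..<n}"
    by simp
  then have "f permutes {..<n}"
    by (rule bij_imp_permutes) (simp only: f_def lessThan_iff if_False)
  then have "Q f"
    by (rule Q_perm)
  moreover have "map (\<lambda>j. hs ! f j) [0..<n] = map ((!) hs) ps" for hs :: "'h list"
    by (rule nth_equalityI) (simp_all add: f_def ps(1))
  ultimately show ?thesis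
    by (simp add: Q_def)
qed

section \<open>Operations on tensor powers over a module\<close>

text \<open>Two maps that agree on lists of length n may be exchanged even when \<open>s\<close> and
  \<open>t\<close> contain other lists: only \<open>s - t\<close> matters, and it is supported on
  lists of length n. This replaces terms depending on \<open>length hs\<close> by terms with a fixed
  n.\<close>

lemma hpow_respects_eq:
  assumes R: "add_subgroup R" and st: "hp n s = hp n t"
    and fg: "\<And>hs. length hs = n \<Longrightarrow> f hs = g hs"
    and g: "coset R (frag_extend g s) = coset R (frag_extend g t)"
  shows "coset R (frag_extend f s) = coset R (frag_extend f t)"
proof -
  have "s - t \<in> hpow_rel H n"
    using st by (simp add: coset_eq_iff)
  then have keys: "Poly_Mapping.keys (s - t) \<subseteq> {hs. length hs = n}"
    by (rule keys_hpow_rel)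
  have "frag_extend f (s - t) = frag_extend g (s - t)"
    by (rule frag_extend_eq) (use keys fg in auto)
  with g R show ?thesis
    by (simp add: coset_eq_iff frag_extend_diff)
qed

lemma keys_tens_rel:
  assumes "r \<in> tens_rel H n actM"
  shows "Poly_Mapping.keys r \<subseteq> {x. length (fst x) = n}"
  using assms unfolding tens_rel_def
proof (induction rule: group_closure.induct)
  case (base s)
  then consider "s = 0"
    | (hpow) r m where "s = frag_extend (\<lambda>hs. frag_of (hs, m)) r" "r \<in> hpow_rel H n"
    | (add) hs m m' where "s = frag_of (hs, m + m') - frag_of (hs, m) - frag_of (hs, m')"
        "length hs = n"
    | (balance) hs h m where "s = frag_extend (\<lambda>gs. frag_of (map2 (*) hs gs, m)) (coprod H n h)
        - frag_of (hs, actM h m)" "length hs = n"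
    by blast
  then show ?case
  proof cases
    case 1
    then show ?thesis by simp
  next
    case hpow
    have "x \<in> {x. length (fst x) = n}" if x: "x \<in> Poly_Mapping.keys s" for x
    proof -
      obtain hs where "hs \<in> Poly_Mapping.keys r" "x \<in> Poly_Mapping.keys (frag_of (hs, m))"
        using x unfolding hpow(1) by (rule keys_frag_extendE)
      then show ?thesis
        using keys_hpow_rel [OF hpow(2)] by auto
    qed
    then show ?thesis by blast
  next
    case add
    then show ?thesis
      by (simp add: keys_diff_subset)
  next
    case balance
    have "Poly_Mapping.keys (frag_extend (\<lambda>gs. frag_of (map2 (*) hs gs, m)) (coprod H n h))
        \<subseteq> {x. length (fst x) = n}"
    proof
      fix x assume "x \<in> Poly_Mapping.keys (frag_extend (\<lambda>gs. frag_of (map2 (*) hs gs, m)) (coprod H n h))"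
      then obtain gs where "gs \<in> Poly_Mapping.keys (coprod H n h)"
        "x \<in> Poly_Mapping.keys (frag_of (map2 (*) hs gs, m))"
        by (rule keys_frag_extendE)
      then show "x \<in> {x. length (fst x) = n}"
        using balance(2) by (simp add: length_keys_coprod)
    qed
    then show ?thesis
      using balance by (simp add: keys_diff_subset)
  qed
next
  case (diff s t)
  then show ?case
    using keys_diff [of s t] by blast
qed

lemma coset_rep_tens:
  assumes "X \<in> tens H n actM"
  shows "coset (tens_rel H n actM) (rep X) = X"
  using assms by (auto simp: tens_def)

lemma length_keys_rep:
  assumes X: "X \<in> tens H n actM" and x: "x \<in> Poly_Mapping.keys (rep X)"
  shows "length (fst x) = n"
proof -
  obtain t where t: "X = coset (tens_rel H n actM) t"
    "Poly_Mapping.keys t \<subseteq> {x. length (fst x) = n}"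
    using X by (auto simp: tens_def case_prod_unfold)
  have "coset (tens_rel H n actM) (rep X) = coset (tens_rel H n actM) t"
    using coset_rep_tens [OF X] t(1) by (rule trans)
  then have "rep X - t \<in> tens_rel H n actM"
    by (rule iffD1 [OF coset_eq_iff [OF add_subgroup_tens_rel]])
  then have "Poly_Mapping.keys (rep X - t) \<subseteq> {x. length (fst x) = n}"
    by (rule keys_tens_rel)
  then show ?thesis
    using x t(2) keys_add [of "rep X - t" t] by (simp only: diff_add_cancel) blast
qed

lemma coset_in_tens:
  assumes "\<And>x. x \<in> Poly_Mapping.keys t \<Longrightarrow> length (fst x) = n"
  shows "coset (tens_rel H n actM) t \<in> tens H n actM"
  unfolding tens_def using assms by (intro imageI) auto

lemma tens_respects_eq:
  assumes R: "add_subgroup R"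
    and st: "coset (tens_rel H n actM) s = coset (tens_rel H n actM) t"
    and fg: "\<And>hs m. length hs = n \<Longrightarrow> f (hs, m) = g (hs, m)"
    and g: "coset R (frag_extend g s) = coset R (frag_extend g t)"
  shows "coset R (frag_extend f s) = coset R (frag_extend f t)"
proof -
  have "s - t \<in> tens_rel H n actM"
    using st by (simp add: coset_eq_iff)
  then have keys: "Poly_Mapping.keys (s - t) \<subseteq> {x. length (fst x) = n}"
    by (rule keys_tens_rel)
  have "frag_extend f (s - t) = frag_extend g (s - t)"
  proof (rule frag_extend_eq)
    fix x assume "x \<in> Poly_Mapping.keys (s - t)"
    with keys show "f x = g x"
      using fg [of "fst x" "snd x"] by auto
  qed
  with g R show ?thesis
    by (simp add: coset_eq_iff frag_extend_diff)
qed

lemma lmult_cong: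
  assumes gs: "length gs = n"
    and eq: "coset (tens_rel H n actM) s = coset (tens_rel H n actM) t"
  shows "coset (tens_rel H n actM) (frag_extend (\<lambda>(hs, m). frag_of (map2 (*) gs hs, m)) s) =
    coset (tens_rel H n actM) (frag_extend (\<lambda>(hs, m). frag_of (map2 (*) gs hs, m)) t)"
proof (rule tens_rel_lift [OF add_subgroup_tens_rel _ _ _ eq])
  fix m and s t :: "'h list \<Rightarrow>\<^sub>0 int"
  assume "hp n s = hp n t"
  from tens_hpow [OF hpow_mult_left [OF gs this], of actM m]
  show "coset (tens_rel H n actM)
      (frag_extend (\<lambda>hs. case (hs, m) of (hs, m) \<Rightarrow> frag_of (map2 (*) gs hs, m)) s) =
    coset (tens_rel H n actM)
      (frag_extend (\<lambda>hs. case (hs, m) of (hs, m) \<Rightarrow> frag_of (map2 (*) gs hs, m)) t)"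
    by (simp add: frag_extend_bind)
next
  fix hs :: "'h list" and m m'
  assume "length hs = n"
  then show "coset (tens_rel H n actM) (case (hs, m + m') of (hs, m) \<Rightarrow> frag_of (map2 (*) gs hs, m)) =
    coset (tens_rel H n actM) ((case (hs, m) of (hs, m) \<Rightarrow> frag_of (map2 (*) gs hs, m)) +
      (case (hs, m') of (hs, m) \<Rightarrow> frag_of (map2 (*) gs hs, m)))"
    using gs by (simp add: tens_add)
next
  fix hs :: "'h list" and h m
  assume "length hs = n"
  then show "coset (tens_rel H n actM) (frag_extend
      (\<lambda>gs'. case (map2 (*) hs gs', m) of (hs, m) \<Rightarrow> frag_of (map2 (*) gs hs, m)) (coprod H n h)) =
    coset (tens_rel H n actM) (case (hs, actM h m) of (hs, m) \<Rightarrow> frag_of (map2 (*) gs hs, m))"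
    using gs by (simp add: map2_mult_assoc tens_balance)
qed

lemma lmult_coset:
  assumes "length gs = n"
  shows "lmult H actM gs (coset (tens_rel H n actM) t) =
    coset (tens_rel H n actM) (frag_extend (\<lambda>(hs, m). frag_of (map2 (*) gs hs, m)) t)"
  unfolding lmult_def induced_def assms
  by (rule lmult_cong) (use assms in simp_all)

lemma reorder_cong:
  fixes actM :: "'h \<Rightarrow> 'm::ab_group_add \<Rightarrow> 'm"
  assumes ps: "length ps = n" "set ps = {..<n}"
    and eq: "coset (tens_rel H n actM) s = coset (tens_rel H n actM) t"
  shows "coset (tens_rel H n actM) (frag_extend (\<lambda>(hs, m). frag_of (map ((!) hs) ps, m)) s) =
    coset (tens_rel H n actM) (frag_extend (\<lambda>(hs, m). frag_of (map ((!) hs) ps, m)) t)"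
proof (rule tens_rel_lift [OF add_subgroup_tens_rel _ _ _ eq])
  fix m and s t :: "'h list \<Rightarrow>\<^sub>0 int"
  assume "hp n s = hp n t"
  from tens_hpow [OF hpow_perm [OF ps this], of actM m]
  show "coset (tens_rel H n actM)
      (frag_extend (\<lambda>hs. case (hs, m) of (hs, m) \<Rightarrow> frag_of (map ((!) hs) ps, m)) s) =
    coset (tens_rel H n actM)
      (frag_extend (\<lambda>hs. case (hs, m) of (hs, m) \<Rightarrow> frag_of (map ((!) hs) ps, m)) t)"
    by (simp add: frag_extend_bind)
next
  fix hs :: "'h list" and m m'
  show "coset (tens_rel H n actM) (case (hs, m + m') of (hs, m) \<Rightarrow> frag_of (map ((!) hs) ps, m)) =
    coset (tens_rel H n actM) ((case (hs, m) of (hs, m) \<Rightarrow> frag_of (map ((!) hs) ps, m)) +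
      (case (hs, m') of (hs, m) \<Rightarrow> frag_of (map ((!) hs) ps, m)))"
    using ps by (simp add: tens_add)
next
  fix hs :: "'h list" and h and m :: 'm
  assume hs: "length hs = n"
  have "frag_extend (\<lambda>gs. frag_of (map ((!) (map2 (*) hs gs)) ps, m)) (coprod H n h) =
      frag_extend (\<lambda>gs. frag_of (map2 (*) (map ((!) hs) ps) (map ((!) gs) ps), m)) (coprod H n h)"
  proof (rule frag_extend_eq)
    fix gs assume "gs \<in> Poly_Mapping.keys (coprod H n h)"
    then have gs: "length gs = n" by (rule length_keys_coprod)
    have "ps ! j < n" if "j < n" for j
      using nth_mem [of j ps] that unfolding ps by simp
    then have "map ((!) (map2 (*) hs gs)) ps = map2 (*) (map ((!) hs) ps) (map ((!) gs) ps)"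
      by (intro nth_equalityI) (simp_all add: hs gs ps(1))
    then show "frag_of (map ((!) (map2 (*) hs gs)) ps, m) =
        frag_of (map2 (*) (map ((!) hs) ps) (map ((!) gs) ps), m)"
      by (rule arg_cong)
  qed
  \<comment> \<open>The permutation has been distributed over the factorwise product;
    cocommutativity now removes it from the coproduct, which leaves an instance of the balancing
    relation.\<close>
  also have "coset (tens_rel H n actM) \<dots> = coset (tens_rel H n actM)
      (frag_extend (\<lambda>gs. frag_of (map2 (*) (map ((!) hs) ps) gs, m)) (coprod H n h))"
    using tens_hpow [OF hpow_mult_left [OF _ coprod_perm [OF ps, of h]], of "map ((!) hs) ps" actM m] ps
    by (simp add: frag_extend_bind)
  also have "\<dots> = coset (tens_rel H n actM) (frag_of (map ((!) hs) ps, actM h m))"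
    using ps by (simp add: tens_balance)
  finally show "coset (tens_rel H n actM) (frag_extend
      (\<lambda>gs. case (map2 (*) hs gs, m) of (hs, m) \<Rightarrow> frag_of (map ((!) hs) ps, m)) (coprod H n h)) =
    coset (tens_rel H n actM) (case (hs, actM h m) of (hs, m) \<Rightarrow> frag_of (map ((!) hs) ps, m))"
    by simp
qed

lemma reorder_coset:
  assumes "length ps = n" "set ps = {..<n}"
  shows "reorder H actM ps (coset (tens_rel H n actM) t) =
    coset (tens_rel H n actM) (frag_extend (\<lambda>(hs, m). frag_of (map ((!) hs) ps, m)) t)"
  unfolding reorder_def induced_def assms(1)
  by (rule reorder_cong) (use assms in simp_all)

lemma id_tens_cong:
  assumes lin: "h_linear actM actN \<theta>"
    and eq: "coset (tens_rel H n actM) s = coset (tens_rel H n actM) t"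
  shows "coset (tens_rel H n actN) (frag_extend (\<lambda>(hs, m). frag_of (hs, \<theta> m)) s) =
    coset (tens_rel H n actN) (frag_extend (\<lambda>(hs, m). frag_of (hs, \<theta> m)) t)"
proof (rule tens_rel_lift [OF add_subgroup_tens_rel _ _ _ eq], unfold prod.case)
  show "coset (tens_rel H n actN) (frag_extend (\<lambda>hs. frag_of (hs, \<theta> m)) s) =
      coset (tens_rel H n actN) (frag_extend (\<lambda>hs. frag_of (hs, \<theta> m)) t)"
    if "hp n s = hp n t" for m s t
    by (rule tens_hpow [OF that])
  show "coset (tens_rel H n actN) (frag_of (hs, \<theta> (m + m'))) =
      coset (tens_rel H n actN) (frag_of (hs, \<theta> m) + frag_of (hs, \<theta> m'))"
    if "length hs = n" for hs m m'
    using tens_add [OF that] lin by (simp add: h_linear_def)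
  show "coset (tens_rel H n actN) (frag_extend (\<lambda>gs. frag_of (map2 (*) hs gs, \<theta> m)) (coprod H n h)) =
      coset (tens_rel H n actN) (frag_of (hs, \<theta> (actM h m)))"
    if "length hs = n" for hs h m
    using tens_balance [OF that] lin by (simp add: h_linear_def)
qed

lemma id_tens_coset:
  assumes "h_linear actM actN \<theta>"
  shows "id_tens H n actN \<theta> (coset (tens_rel H n actM) t) =
    coset (tens_rel H n actN) (frag_extend (\<lambda>(hs, m). frag_of (hs, \<theta> m)) t)"
  unfolding id_tens_def induced_def
  by (rule id_tens_cong [OF assms]) simp

section \<open>Inserting coproducts in tensor powers over a module\<close>

lemma length_keys_insert_coprod:
  assumes "zs \<in> Poly_Mapping.keys (insert_coprod m l hs)" "m < length hs"
  shows "length zs = length hs + l - 1"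
proof -
  obtain gs where "gs \<in> Poly_Mapping.keys (coprod H l (hs ! m))"
    "zs \<in> Poly_Mapping.keys (frag_of (take m hs @ gs @ drop (Suc m) hs))"
    using assms(1) unfolding insert_coprod_def by (rule keys_frag_extendE)
  with assms(2) show ?thesis
    by (simp add: length_keys_coprod)
qed

lemma insert_coprod_mult:
  assumes l: "0 < l" and m: "m < k" and N: "N = k + l - 1" and len: "length fs = k" "length gs = k"
  shows "hp N (insert_coprod m l (map2 (*) fs gs)) =
    hp N (frag_extend (\<lambda>xs. frag_extend (\<lambda>ys. frag_of (map2 (*) xs ys)) (insert_coprod m l gs))
      (insert_coprod m l fs))"
proof -
  let ?xs = "map2 (*) (take m fs) (take m gs)" and ?ys = "map2 (*) (drop (Suc m) fs) (drop (Suc m) gs)"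
  have td: "take m (map2 (*) fs gs) = ?xs" "drop (Suc m) (map2 (*) fs gs) = ?ys"
    by (simp_all add: take_map drop_map take_zip drop_zip)
  have "hp N (insert_coprod m l (map2 (*) fs gs)) =
      hp N (frag_extend (\<lambda>zs. frag_of (?xs @ zs @ ?ys)) (coprod H l (fs ! m * gs ! m)))"
    using m len by (simp add: insert_coprod_def td)
  also have "\<dots> = hp N (frag_extend (\<lambda>zs. frag_of (?xs @ zs @ ?ys))
      (frag_extend (\<lambda>xs. frag_extend (\<lambda>ys. frag_of (map2 (*) xs ys)) (coprod H l (gs ! m)))
        (coprod H l (fs ! m))))"
    by (rule hpow_context [OF coprod_mult [OF l]]) (use m len N l in simp)
  also have "\<dots> = hp N (frag_extend (\<lambda>xs. frag_extend (\<lambda>ys. frag_of (map2 (*) xs ys)) (insert_coprod m l gs))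
      (insert_coprod m l fs))"
    unfolding insert_coprod_def frag_extend_bind frag_extend_of
    by (intro arg_cong [where f = "hp N"] frag_extend_eq)
      (use len m in \<open>auto dest!: length_keys_coprod\<close>)
  finally show ?thesis .
qed

text \<open>The insertion is multiplicative (\<open>insert_coprod_mult\<close>) and sends the k-fold
  coproduct of h to the N-fold one (\<open>insert_coprod_coprod\<close>). Hence it carries the
  balancing relation for k factors to the one for N factors.\<close>

lemma insert_tens_cong:
  fixes actM :: "'h \<Rightarrow> 'm::ab_group_add \<Rightarrow> 'm"
  assumes l: "0 < l" and m: "m < k" and N: "N = k + l - 1"
    and eq: "coset (tens_rel H k actM) s = coset (tens_rel H k actM) t"
  shows "coset (tens_rel H N actM)
      (frag_extend (\<lambda>(fs, e). frag_extend (\<lambda>zs. frag_of (zs, e)) (insert_coprod m l fs)) s) =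
    coset (tens_rel H N actM)
      (frag_extend (\<lambda>(fs, e). frag_extend (\<lambda>zs. frag_of (zs, e)) (insert_coprod m l fs)) t)"
proof (rule tens_rel_lift [OF add_subgroup_tens_rel _ _ _ eq], unfold prod.case)
  fix e and s t :: "'h list \<Rightarrow>\<^sub>0 int"
  assume "hp k s = hp k t"
  from tens_hpow [OF insert_coprod_cong [OF l m N this], of actM e]
  show "coset (tens_rel H N actM)
      (frag_extend (\<lambda>fs. frag_extend (\<lambda>zs. frag_of (zs, e)) (insert_coprod m l fs)) s) =
    coset (tens_rel H N actM)
      (frag_extend (\<lambda>fs. frag_extend (\<lambda>zs. frag_of (zs, e)) (insert_coprod m l fs)) t)"
    by (simp add: frag_extend_bind)
next
  fix fs :: "'h list" and e e'
  assume "length fs = k"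
  then show "coset (tens_rel H N actM) (frag_extend (\<lambda>zs. frag_of (zs, e + e')) (insert_coprod m l fs)) =
    coset (tens_rel H N actM) (frag_extend (\<lambda>zs. frag_of (zs, e)) (insert_coprod m l fs) +
      frag_extend (\<lambda>zs. frag_of (zs, e')) (insert_coprod m l fs))"
    unfolding frag_extend_add_fun [symmetric]
    by (intro frag_extend_coset_cong add_subgroup_tens_rel tens_add)
      (use m N in \<open>auto dest: length_keys_insert_coprod\<close>)
next
  fix fs :: "'h list" and h and e :: 'm
  assume fs: "length fs = k"
  have "hp N (frag_extend (\<lambda>gs. insert_coprod m l (map2 (*) fs gs)) (coprod H k h)) =
      hp N (frag_extend (\<lambda>gs. frag_extend (\<lambda>xs. frag_extend (\<lambda>ys. frag_of (map2 (*) xs ys))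
        (insert_coprod m l gs)) (insert_coprod m l fs)) (coprod H k h))"
    by (intro frag_extend_coset_cong add_subgroup_hpow_rel insert_coprod_mult [OF l m N fs])
      (rule length_keys_coprod)
  also have "\<dots> = hp N (frag_extend (\<lambda>xs. frag_extend (\<lambda>gs. frag_extend (\<lambda>ys. frag_of (map2 (*) xs ys))
        (insert_coprod m l gs)) (coprod H k h)) (insert_coprod m l fs))"
    by (subst frag_extend_swap) (rule refl)
  also have "\<dots> = hp N (frag_extend (\<lambda>xs. frag_extend (\<lambda>ys. frag_of (map2 (*) xs ys)) (coprod H N h))
      (insert_coprod m l fs))"
  proof (rule frag_extend_coset_cong [OF add_subgroup_hpow_rel])
    fix xs assume "xs \<in> Poly_Mapping.keys (insert_coprod m l fs)"
    then have "length xs = N"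
      using fs m N by (auto dest: length_keys_insert_coprod)
    from hpow_mult_left [OF this insert_coprod_coprod [OF l m N, of h]]
    show "hp N (frag_extend (\<lambda>gs. frag_extend (\<lambda>ys. frag_of (map2 (*) xs ys))
        (insert_coprod m l gs)) (coprod H k h)) =
      hp N (frag_extend (\<lambda>ys. frag_of (map2 (*) xs ys)) (coprod H N h))"
      by (simp add: frag_extend_bind)
  qed
  finally have "coset (tens_rel H N actM) (frag_extend (\<lambda>gs. frag_extend (\<lambda>zs. frag_of (zs, e))
      (insert_coprod m l (map2 (*) fs gs))) (coprod H k h)) =
    coset (tens_rel H N actM) (frag_extend (\<lambda>xs. frag_extend (\<lambda>ys. frag_of (map2 (*) xs ys, e))
      (coprod H N h)) (insert_coprod m l fs))"
    by (auto dest: tens_hpow [where actM = actM and m = e] simp: frag_extend_bind)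
  also have "\<dots> = coset (tens_rel H N actM) (frag_extend (\<lambda>zs. frag_of (zs, actM h e)) (insert_coprod m l fs))"
    by (intro frag_extend_coset_cong add_subgroup_tens_rel tens_balance)
      (use fs m N in \<open>auto dest: length_keys_insert_coprod\<close>)
  finally show "coset (tens_rel H N actM) (frag_extend (\<lambda>gs. frag_extend (\<lambda>zs. frag_of (zs, e))
      (insert_coprod m l (map2 (*) fs gs))) (coprod H k h)) =
    coset (tens_rel H N actM) (frag_extend (\<lambda>zs. frag_of (zs, actM h e)) (insert_coprod m l fs))" .
qed

section \<open>Composition of polylinear maps\<close>

definition compose_term :: "nat \<Rightarrow> 'h list \<Rightarrow> 'h list \<times> 'm \<Rightarrow> ('h list \<times> 'm \<Rightarrow>\<^sub>0 int)" where
  "compose_term m hs = (\<lambda>(fs, e'). frag_extend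
     (\<lambda>gs. frag_of (take m fs @ map2 (*) hs gs @ drop (Suc m) fs, e'))
     (coprod H (length hs) (fs ! m)))"

text \<open>For fixed \<open>hs\<close> the composition is the insertion of an l-fold coproduct at
  factor m, followed by left multiplication by \<open>hs\<close> padded with ones, and both descend.
  The factorisation holds for lists of length k only, hence \<open>tens_respects_eq\<close>.\<close>

lemma compose_term_cong:
  assumes hs: "length hs = l" and l: "0 < l" and m: "m < k" and N: "N = k + l - 1"
    and eq: "coset (tens_rel H k actM) s = coset (tens_rel H k actM) t"
  shows "coset (tens_rel H N actM) (frag_extend (compose_term m hs) s) =
    coset (tens_rel H N actM) (frag_extend (compose_term m hs) t)"
proof (rule tens_respects_eq [OF add_subgroup_tens_rel eq])
  let ?U = "replicate m 1 @ hs @ replicate (k - Suc m) 1"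
  let ?g = "\<lambda>x. frag_extend (\<lambda>(zs, e). frag_of (map2 (*) ?U zs, e))
    (case x of (fs, e) \<Rightarrow> frag_extend (\<lambda>zs. frag_of (zs, e)) (insert_coprod m l fs))"
  have "length ?U = N"
    using hs l m N by simp
  from lmult_cong [OF this insert_tens_cong [OF l m N eq]]
  show "coset (tens_rel H N actM) (frag_extend ?g s) = coset (tens_rel H N actM) (frag_extend ?g t)"
    by (simp add: frag_extend_bind)
  fix fs :: "'h list" and e
  assume fs: "length fs = k"
  show "compose_term m hs (fs, e) = ?g (fs, e)"
    unfolding compose_term_def prod.case insert_coprod_def frag_extend_bind frag_extend_of hs
    by (rule frag_extend_eq)
      (use fs m hs map2_mult_pad [of m fs hs] in \<open>auto dest!: length_keys_coprod\<close>)
qed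

text \<open>Polylinearity in the one argument that receives the insertion, all others being fixed: h
  acts through 1 \<otimes> ... \<otimes> h \<otimes> ... \<otimes> 1 with h in factor m. The same
  notion covers insertion into maps of two and of three arguments.\<close>

definition slot_linear where
  "slot_linear k m actE actM p \<longleftrightarrow> (\<forall>e. p e \<in> tens H k actM) \<and>
     (\<forall>e e'. p (e + e') = p e \<oplus> p e') \<and>
     (\<forall>h e. p (actE h e) = lmult H actM ((replicate k 1)[m := h]) (p e))"

text \<open>Independence of the inserted class. \<open>compose_term_cong\<close> supplies
  independence of the representatives \<open>rep (p e)\<close>, so each relation on the pairs (hs,
  e) can be checked after rewriting \<open>p\<close> by additivity or H-linearity.\<close>

lemma compose_cong:
  assumes p: "slot_linear k m actE actM p" and l: "0 < l" and m: "m < k" and N: "N = k + l - 1"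
    and eq: "coset (tens_rel H l actE) s = coset (tens_rel H l actE) t"
  shows "coset (tens_rel H N actM) (frag_extend (\<lambda>(hs, e). frag_extend (compose_term m hs) (rep (p e))) s) =
    coset (tens_rel H N actM) (frag_extend (\<lambda>(hs, e). frag_extend (compose_term m hs) (rep (p e))) t)"
proof (rule tens_rel_lift [OF add_subgroup_tens_rel _ _ _ eq], unfold prod.case)
  have len: "length fs = k" if "(fs, e') \<in> Poly_Mapping.keys (rep (p e))" for fs e' e
    using length_keys_rep [OF _ that, of k actM] p by (simp add: slot_linear_def)
  have rep: "coset (tens_rel H k actM) (rep (p e)) = p e" for e
    using p by (simp add: slot_linear_def coset_rep_tens)
  {
    fix e and s t :: "'h list \<Rightarrow>\<^sub>0 int"
    assume st: "hp l s = hp l t"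
    let ?g = "\<lambda>hs. frag_extend (\<lambda>(fs, e'). frag_extend
       (\<lambda>gs. frag_of (take m fs @ map2 (*) hs gs @ drop (Suc m) fs, e')) (coprod H l (fs ! m))) (rep (p e))"
    show "coset (tens_rel H N actM) (frag_extend (\<lambda>hs. frag_extend (compose_term m hs) (rep (p e))) s) =
      coset (tens_rel H N actM) (frag_extend (\<lambda>hs. frag_extend (compose_term m hs) (rep (p e))) t)"
    proof (rule hpow_respects_eq [OF add_subgroup_tens_rel st, where g = ?g])
      show "frag_extend (compose_term m hs) (rep (p e)) = ?g hs" if "length hs = l" for hs
        using that by (simp add: compose_term_def)
      \<comment> \<open>The sum over \<open>hs\<close> is moved innermost. There it is a right
        multiplication by a fixed \<open>gs\<close> inside a fixed context, and both respect the
        relations of the l-th tensor power.\<close>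
      have swap: "frag_extend ?g s = frag_extend (\<lambda>(fs, e'). frag_extend (\<lambda>gs. frag_extend
          (\<lambda>hs. frag_of (take m fs @ map2 (*) hs gs @ drop (Suc m) fs, e')) s) (coprod H l (fs ! m)))
          (rep (p e))" for s
        unfolding case_prod_unfold frag_extend_swap [where s = s] ..
      show "coset (tens_rel H N actM) (frag_extend ?g s) = coset (tens_rel H N actM) (frag_extend ?g t)"
        unfolding swap
      proof (rule frag_extend_coset_cong [OF add_subgroup_tens_rel], clarify)
        fix fs e'
        assume "(fs, e') \<in> Poly_Mapping.keys (rep (p e))"
        then have fs: "length fs = k" by (rule len)
        show "coset (tens_rel H N actM) (frag_extend (\<lambda>gs. frag_extend
            (\<lambda>hs. frag_of (take m fs @ map2 (*) hs gs @ drop (Suc m) fs, e')) s) (coprod H l (fs ! m))) =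
          coset (tens_rel H N actM) (frag_extend (\<lambda>gs. frag_extend
            (\<lambda>hs. frag_of (take m fs @ map2 (*) hs gs @ drop (Suc m) fs, e')) t) (coprod H l (fs ! m)))"
        proof (rule frag_extend_coset_cong [OF add_subgroup_tens_rel])
          fix gs assume "gs \<in> Poly_Mapping.keys (coprod H l (fs ! m))"
          then have gs: "length gs = l" by (rule length_keys_coprod)
          have "N = length (take m fs) + l + length (drop (Suc m) fs)"
            using fs m N l by simp
          from tens_hpow [OF hpow_context [OF hpow_mult_right [OF gs st] this], of actM e']
          show "coset (tens_rel H N actM)
              (frag_extend (\<lambda>hs. frag_of (take m fs @ map2 (*) hs gs @ drop (Suc m) fs, e')) s) =
            coset (tens_rel H N actM)
              (frag_extend (\<lambda>hs. frag_of (take m fs @ map2 (*) hs gs @ drop (Suc m) fs, e')) t)"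
            by (simp add: frag_extend_bind)
        qed
      qed
    qed
  }
  {
    fix hs :: "'h list" and e e'
    assume hs: "length hs = l"
    have "coset (tens_rel H k actM) (rep (p (e + e'))) = p e \<oplus> p e'"
      unfolding rep using p by (simp add: slot_linear_def)
    then have "coset (tens_rel H k actM) (rep (p (e + e'))) =
        coset (tens_rel H k actM) (rep (p e) + rep (p e'))"
      unfolding coset_add [OF add_subgroup_tens_rel] rep .
    from compose_term_cong [OF hs l m N this]
    show "coset (tens_rel H N actM) (frag_extend (compose_term m hs) (rep (p (e + e')))) =
      coset (tens_rel H N actM) (frag_extend (compose_term m hs) (rep (p e)) +
        frag_extend (compose_term m hs) (rep (p e')))"
      by (simp add: frag_extend_add)
  }
  {
    fix hs :: "'h list" and h :: 'h and e
    assume hs: "length hs = l"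
    let ?U = "(replicate k 1)[m := h]"
    have "p (actE h e) = lmult H actM ?U (coset (tens_rel H k actM) (rep (p e)))"
      unfolding rep using p by (simp add: slot_linear_def)
    also have "\<dots> =
        coset (tens_rel H k actM) (frag_extend (\<lambda>(fs, e'). frag_of (map2 (*) ?U fs, e')) (rep (p e)))"
      by (rule lmult_coset) simp
    finally have "coset (tens_rel H k actM) (rep (p (actE h e))) =
        coset (tens_rel H k actM) (frag_extend (\<lambda>(fs, e'). frag_of (map2 (*) ?U fs, e')) (rep (p e)))"
      unfolding rep .
    from compose_term_cong [OF hs l m N this]
    have "coset (tens_rel H N actM) (frag_extend (compose_term m hs) (rep (p (actE h e)))) =
        coset (tens_rel H N actM)
          (frag_extend (\<lambda>(fs, e'). compose_term m hs (map2 (*) ?U fs, e')) (rep (p e)))"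
      by (simp add: frag_extend_bind case_prod_unfold)
    also have "\<dots> = coset (tens_rel H N actM) (frag_extend (\<lambda>(fs, e'). frag_extend
        (\<lambda>gs. compose_term m (map2 (*) hs gs) (fs, e')) (coprod H l h)) (rep (p e)))"
    proof (rule frag_extend_coset_cong [OF add_subgroup_tens_rel], clarify)
      fix fs e'
      assume "(fs, e') \<in> Poly_Mapping.keys (rep (p e))"
      then have fs: "length fs = k" by (rule len)
      have U: "map2 (*) ?U fs = fs[m := h * fs ! m]"
        using fs m by (intro nth_equalityI) (auto simp: nth_list_update)
      have len': "N = length (take m fs) + l + length (drop (Suc m) fs)"
        using fs m N l by simp
      have "coset (tens_rel H N actM) (compose_term m hs (map2 (*) ?U fs, e')) =
          coset (tens_rel H N actM) (frag_extend
            (\<lambda>cs. frag_of (take m fs @ map2 (*) hs cs @ drop (Suc m) fs, e')) (coprod H l (h * fs ! m)))"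
        using fs m hs unfolding U by (simp add: compose_term_def)
      \<comment> \<open>H-linearity of \<open>p\<close> has put h to the left of entry m. The
        coproduct of the product is the product of the coproducts, and associativity attaches the
        coproduct of h to \<open>hs\<close>, as on the other side of the balancing relation.\<close>
      also have "\<dots> = coset (tens_rel H N actM) (frag_extend (\<lambda>gs. frag_extend
            (\<lambda>cs. frag_of (take m fs @ map2 (*) hs (map2 (*) gs cs) @ drop (Suc m) fs, e'))
            (coprod H l (fs ! m))) (coprod H l h))"
        using tens_hpow [OF hpow_context [OF hpow_mult_left [OF hs coprod_mult [OF l, of h "fs ! m"]] len'],
            of actM e']
        by (simp add: frag_extend_bind)
      also have "\<dots> = coset (tens_rel H N actM)
          (frag_extend (\<lambda>gs. compose_term m (map2 (*) hs gs) (fs, e')) (coprod H l h))"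
        unfolding compose_term_def prod.case
        by (intro arg_cong [where f = "coset (tens_rel H N actM)"] frag_extend_eq)
          (simp add: map2_mult_assoc length_keys_coprod hs)
      finally show "coset (tens_rel H N actM) (compose_term m hs (map2 (*) ?U fs, e')) =
          coset (tens_rel H N actM)
            (frag_extend (\<lambda>gs. compose_term m (map2 (*) hs gs) (fs, e')) (coprod H l h))" .
    qed
    also have "\<dots> = coset (tens_rel H N actM) (frag_extend
        (\<lambda>gs. frag_extend (compose_term m (map2 (*) hs gs)) (rep (p e))) (coprod H l h))"
      unfolding case_prod_unfold prod.collapse
      by (subst frag_extend_swap) (rule refl)
    finally show "coset (tens_rel H N actM) (frag_extend
        (\<lambda>gs. frag_extend (compose_term m (map2 (*) hs gs)) (rep (p e))) (coprod H l h)) =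
      coset (tens_rel H N actM) (frag_extend (compose_term m hs) (rep (p (actE h e))))"
      by (rule sym)
  }
qed

lemma compose_at_alt:
  "compose_at H N actM m p X =
    coset (tens_rel H N actM) (frag_extend (\<lambda>(hs, e). frag_extend (compose_term m hs) (rep (p e))) (rep X))"
  by (simp add: compose_at_def induced_def compose_term_def)

lemma compose_at_coset:
  assumes "slot_linear k m actE actM p" "0 < l" "m < k" "N = k + l - 1"
  shows "compose_at H N actM m p (coset (tens_rel H l actE) t) =
    coset (tens_rel H N actM) (frag_extend (\<lambda>(hs, e). frag_extend (compose_term m hs) (rep (p e))) t)"
  unfolding compose_at_alt by (rule compose_cong [OF assms]) simp

text \<open>Both sides start from the same formal sum \<open>rep X\<close>. The left side passes
  through another representative of the image class, which \<open>compose_at_coset\<close>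
  permits.\<close>

lemma compose_at_id_tens:
  assumes "slot_linear k m actE actM p" "0 < l" "m < k" "N = k + l - 1"
  shows "compose_at H N actM m p (id_tens H l actE \<theta> X) = compose_at H N actM m (\<lambda>e. p (\<theta> e)) X"
  unfolding id_tens_def induced_def compose_at_coset [OF assms]
  unfolding compose_at_alt frag_extend_bind
  by (simp add: case_prod_unfold)

lemma compose_at_tzero:
  assumes "slot_linear k m actE actM p" "0 < l" "m < k" "N = k + l - 1"
  shows "compose_at H N actM m p (tzero H l actE) = tzero H N actM"
  by (simp add: compose_at_coset [OF assms])

text \<open>The representative chosen for the zero class is some relation, possibly nonzero as a
  formal sum, so \<open>compose_term_cong\<close> is needed to replace it by 0.\<close>

lemma compose_at_zero:
  assumes X: "X \<in> tens H l actE" and l: "0 < l" and m: "m < k" and N: "N = k + l - 1"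
  shows "compose_at H N actM m (\<lambda>e. tzero H k actM) X = tzero H N actM"
proof -
  have "coset (tens_rel H N actM) (frag_extend (\<lambda>(hs, e :: 'a).
      frag_extend (compose_term m hs) (rep (tzero H k actM))) (rep X)) =
    coset (tens_rel H N actM) (frag_extend (\<lambda>x. 0) (rep X))"
  proof (rule frag_extend_coset_cong [OF add_subgroup_tens_rel], clarify)
    fix hs :: "'h list" and e
    assume "(hs, e) \<in> Poly_Mapping.keys (rep X)"
    then have hs: "length hs = l"
      using length_keys_rep [OF X] by fastforce
    have "coset (tens_rel H k actM) (rep (tzero H k actM)) = tzero H k actM"
      by simp
    from compose_term_cong [OF hs l m N this]
    show "coset (tens_rel H N actM) (frag_extend (compose_term m hs) (rep (tzero H k actM))) = tzero H N actM"
      by simp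
  qed
  then show ?thesis
    by (simp add: compose_at_alt)
qed

section \<open>The correspondence\<close>

lemma compose_at_in_cosets:
  obtains t where "compose_at H N actM m p X = coset (tens_rel H N actM) t"
  unfolding compose_at_def induced_def by blast

lemma reorder_in_cosets:
  assumes "length ps = n"
  obtains t where "reorder H actM ps X = coset (tens_rel H n actM) t"
  using assms unfolding reorder_def induced_def by blast

lemma coset_diff_add_eq_zero_iff:
  assumes "add_subgroup R"
  shows "coset R a \<ominus> coset R b \<oplus> coset R c = coset R 0 \<longleftrightarrow> coset R a = coset R b \<ominus> coset R c"
  using assms by (simp add: coset_eq_iff algebra_simps flip: coset_add coset_diff)

text \<open>Passes between the form a - b + c = 0 of (iii) and (iv) and the form a = b - c of the
  Lie identities. Cancellation is available because compositions and reorderings are always cosets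
  of the same subgroup.\<close>

lemma compose_jacobi_iff:
  "compose_at H 3 actM i p X \<ominus> compose_at H 3 actM j q Y
      \<oplus> reorder H actM [1, 0, 2] (compose_at H 3 actM k r Z) = tzero H 3 actM \<longleftrightarrow>
    compose_at H 3 actM i p X = compose_at H 3 actM j q Y
      \<ominus> reorder H actM [1, 0, 2] (compose_at H 3 actM k r Z)"
proof -
  obtain a where a: "compose_at H 3 actM i p X = coset (tens_rel H 3 actM) a"
    by (rule compose_at_in_cosets)
  obtain b where b: "compose_at H 3 actM j q Y = coset (tens_rel H 3 actM) b"
    by (rule compose_at_in_cosets)
  have "length [1, 0, 2 :: nat] = 3"
    by simp
  then obtain c where c: "reorder H actM [1, 0, 2] (compose_at H 3 actM k r Z) =
      coset (tens_rel H 3 actM) c"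
    by (rule reorder_in_cosets)
  show ?thesis
    unfolding a b c by (rule coset_diff_add_eq_zero_iff) simp
qed

lemma slot_linear_0:
  assumes "polylinear2 H actA actB actM f" "left_module actB"
  shows "slot_linear 2 0 actA actM (\<lambda>e. f e y)"
proof -
  have "f (actA h e) y = lmult H actM [h, 1] (f e y)" for h e
    using assms unfolding polylinear2_def left_module_def by metis
  with assms show ?thesis
    by (simp add: slot_linear_def polylinear2_def numeral_2_eq_2)
qed

lemma slot_linear_1:
  assumes "polylinear2 H actA actB actM f" "left_module actA"
  shows "slot_linear 2 1 actB actM (f x)"
proof -
  have "f x (actB h e) = lmult H actM [1, h] (f x e)" for h e
    using assms unfolding polylinear2_def left_module_def by metis
  with assms show ?thesis
    by (simp add: slot_linear_def polylinear2_def numeral_2_eq_2)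
qed

section \<open>Zero classes and the exchange of two factors\<close>

lemma class_neg_tzero: "class_neg (tzero H n actM) = tzero H n actM"
  by (simp flip: coset_neg)

lemma reorder_tzero: "length ps = n \<Longrightarrow> set ps = {..<n} \<Longrightarrow> reorder H actM ps (tzero H n actM) = tzero H n actM"
  by (subst reorder_coset) simp_all

lemma lmult_tzero: "length gs = n \<Longrightarrow> lmult H actM gs (tzero H n actM) = tzero H n actM"
  by (subst lmult_coset) simp_all

lemma id_tens_tzero:
  "h_linear actM actN \<theta> \<Longrightarrow> id_tens H n actN \<theta> (tzero H n actM) = tzero H n actN"
  by (subst id_tens_coset) simp_all

lemma tzero_in_tens: "tzero H n actM \<in> tens H n actM"
  by (rule coset_in_tens) simp

lemma tzero_add: "tzero H n actM \<oplus> tzero H n actM = tzero H n actM"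
  by (simp flip: coset_add)

lemma tzero_diff: "tzero H n actM \<ominus> tzero H n actM = tzero H n actM"
  by (simp flip: coset_diff)

lemma reorder_neg:
  assumes "length ps = n" "set ps = {..<n}" "X \<in> tens H n actM"
  shows "reorder H actM ps (class_neg X) = class_neg (reorder H actM ps X)"
proof -
  obtain t where "X = coset (tens_rel H n actM) t"
    using assms(3) by (auto simp: tens_def)
  then show ?thesis
    by (simp add: reorder_coset [OF assms(1,2)] frag_extend_minus flip: coset_neg)
qed

lemma class_neg_in_tens:
  assumes "X \<in> tens H n actM"
  shows "class_neg X \<in> tens H n actM"
proof -
  have "class_neg X = coset (tens_rel H n actM) (- rep X)"
    using coset_rep_tens [OF assms] by (simp add: coset_neg)
  also have "\<dots> \<in> tens H n actM"
    by (rule coset_in_tens) (simp add: length_keys_rep [OF assms])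
  finally show ?thesis .
qed

lemma class_neg_neg: "class_neg (class_neg X) = X"
  by (auto simp: mem_class_neg)

lemma reorder_in_tens:
  assumes "length ps = n"
  shows "reorder H actM ps X \<in> tens H n actM"
  unfolding reorder_def induced_def assms
proof (rule coset_in_tens)
  fix x assume "x \<in> Poly_Mapping.keys (frag_extend (\<lambda>(hs, m). frag_of (map ((!) hs) ps, m)) (rep X))"
  then obtain y where "x \<in> Poly_Mapping.keys (case y of (hs, m) \<Rightarrow> frag_of (map ((!) hs) ps, m))"
    by (rule keys_frag_extendE)
  then show "length (fst x) = n"
    using assms by (cases y) simp
qed

lemma set_swap: "set [1, 0] = {..<2 :: nat}"
  by auto

lemma reorder_swap_swap:
  assumes X: "X \<in> tens H 2 actM"
  shows "reorder H actM [1, 0] (reorder H actM [1, 0] X) = X"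
proof -
  note coset = reorder_coset [OF _ set_swap, of actM, simplified]
  have "reorder H actM [1, 0] (reorder H actM [1, 0] (coset (tens_rel H 2 actM) (rep X))) =
      coset (tens_rel H 2 actM) (frag_extend (\<lambda>x. frag_of ([fst x ! 0, fst x ! 1], snd x)) (rep X))"
    by (simp add: coset frag_extend_bind case_prod_unfold)
  also have "frag_extend (\<lambda>x. frag_of ([fst x ! 0, fst x ! 1], snd x)) (rep X) = frag_extend frag_of (rep X)"
  proof (rule frag_extend_eq)
    fix x assume "x \<in> Poly_Mapping.keys (rep X)"
    then have "length (fst x) = 2"
      by (rule length_keys_rep [OF X])
    then have "[fst x ! 0, fst x ! 1] = fst x"
      by (auto simp: numeral_2_eq_2 length_Suc_conv)
    then show "frag_of ([fst x ! 0, fst x ! 1], snd x) = frag_of x"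
      by simp
  qed
  finally show ?thesis
    by (simp add: coset_rep_tens [OF X])
qed

text \<open>The exchange of two factors is an involution commuting with negation. The equivalence
  solves skew-symmetry for the component on degrees 1 and 0, and so yields both its existence and
  its uniqueness.\<close>

lemma reorder_swap_eq_iff:
  assumes "X \<in> tens H 2 actM" "Y \<in> tens H 2 actM"
  shows "reorder H actM [1, 0] X = class_neg Y \<longleftrightarrow> X = class_neg (reorder H actM [1, 0] Y)"
proof
  assume "reorder H actM [1, 0] X = class_neg Y"
  then have "reorder H actM [1, 0] (reorder H actM [1, 0] X) = class_neg (reorder H actM [1, 0] Y)"
    using reorder_neg [OF _ set_swap assms(2)] by simp
  then show "X = class_neg (reorder H actM [1, 0] Y)"
    using assms by (simp add: reorder_swap_swap [simplified])
next
  assume "X = class_neg (reorder H actM [1, 0] Y)"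
  then show "reorder H actM [1, 0] X = class_neg Y"
    using reorder_neg [OF _ set_swap reorder_in_tens, of "[1, 0]" actM Y] assms
    by (simp add: reorder_swap_swap [simplified])
qed

lemma reorder_swap_lmult:
  assumes X: "X \<in> tens H 2 actM"
  shows "reorder H actM [1, 0] (lmult H actM [g, h] X) = lmult H actM [h, g] (reorder H actM [1, 0] X)"
proof -
  note rc = reorder_coset [OF _ set_swap, of actM, simplified] and lc = lmult_coset [of _ 2 actM]
  have "reorder H actM [1, 0] (lmult H actM [g, h] (coset (tens_rel H 2 actM) (rep X))) =
      coset (tens_rel H 2 actM) (frag_extend (\<lambda>x. frag_of (map ((!) (map2 (*) [g, h] (fst x))) [1, 0], snd x)) (rep X))"
    by (simp add: rc lc frag_extend_bind case_prod_unfold)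
  also have "frag_extend (\<lambda>x. frag_of (map ((!) (map2 (*) [g, h] (fst x))) [1, 0], snd x)) (rep X) =
      frag_extend (\<lambda>x. frag_of (map2 (*) [h, g] (map ((!) (fst x)) [1, 0]), snd x)) (rep X)"
  proof (rule frag_extend_eq)
    fix x assume "x \<in> Poly_Mapping.keys (rep X)"
    then have "length (fst x) = 2"
      by (rule length_keys_rep [OF X])
    then obtain a b where "fst x = [a, b]"
      by (auto simp: numeral_2_eq_2 length_Suc_conv)
    then show "frag_of (map ((!) (map2 (*) [g, h] (fst x))) [1, 0], snd x) =
        frag_of (map2 (*) [h, g] (map ((!) (fst x)) [1, 0]), snd x)"
      by simp
  qed
  also have "coset (tens_rel H 2 actM) \<dots> =
      lmult H actM [h, g] (reorder H actM [1, 0] (coset (tens_rel H 2 actM) (rep X)))"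
    by (simp add: rc lc frag_extend_bind case_prod_unfold)
  finally show ?thesis
    by (simp add: coset_rep_tens [OF X])
qed

text \<open>Exchanging the two factors turns left multiplication by g \<otimes> h into left
  multiplication by h \<otimes> g, which matches the exchange of the arguments. This makes the
  component defined by skew-symmetry polylinear.\<close>

lemma polylinear2_swap:
  assumes f: "polylinear2 H actA actB actM f"
  shows "polylinear2 H actB actA actM (\<lambda>y x. class_neg (reorder H actM [1, 0] (f x y)))"
proof -
  let ?T = "coset (tens_rel H 2 actM)"
  let ?r = "reorder H actM [1, 0]"
  note rc = reorder_coset [OF _ set_swap, of actM, simplified]
  have in_tens: "f x y \<in> tens H 2 actM" for x y
    using f by (simp add: polylinear2_def)
  have add: "class_neg (?r (X \<oplus> Y)) = class_neg (?r X) \<oplus> class_neg (?r Y)"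
    if XY: "X \<in> tens H 2 actM" "Y \<in> tens H 2 actM" for X Y
  proof -
    obtain s t where st: "X = ?T s" "Y = ?T t"
      using XY by (auto simp: tens_def)
    show ?thesis
      unfolding st coset_add [OF add_subgroup_tens_rel, symmetric]
      by (simp add: rc frag_extend_add flip: coset_add coset_neg)
  qed
  have lmult_neg: "lmult H actM [g, h] (class_neg X) = class_neg (lmult H actM [g, h] X)"
    if X: "X \<in> tens H 2 actM" for g h X
  proof -
    obtain t where t: "X = ?T t"
      using X by (auto simp: tens_def)
    show ?thesis
      unfolding t coset_neg [OF add_subgroup_tens_rel, symmetric]
      by (simp add: lmult_coset [of _ 2] frag_extend_minus flip: coset_neg)
  qed
  show ?thesis
    unfolding polylinear2_def
  proof (intro conjI allI)
    fix x x' y y' g h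
    show "class_neg (?r (f x y)) \<in> tens H 2 actM"
      by (intro class_neg_in_tens reorder_in_tens) simp
    show "class_neg (?r (f x (y + y'))) = class_neg (?r (f x y)) \<oplus> class_neg (?r (f x y'))"
      using f by (simp add: polylinear2_def add [OF in_tens in_tens, simplified])
    show "class_neg (?r (f (x + x') y)) = class_neg (?r (f x y)) \<oplus> class_neg (?r (f x' y))"
      using f by (simp add: polylinear2_def add [OF in_tens in_tens, simplified])
    have "f (actA h x) (actB g y) = lmult H actM [h, g] (f x y)"
      using f by (simp add: polylinear2_def)
    then show "class_neg (?r (f (actA h x) (actB g y))) = lmult H actM [g, h] (class_neg (?r (f x y)))"
      using lmult_neg [OF reorder_in_tens, of "[1, 0]" g h "f x y"]
      by (simp add: reorder_swap_lmult [OF in_tens, simplified])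
  qed
qed

lemma polylinear3_tzero: "polylinear3 H actA actB actC actM (\<lambda>x y z. tzero H 3 actM)"
  by (simp add: polylinear3_def tzero_in_tens tzero_add lmult_tzero)

section \<open>Strict structures and crossed modules\<close>

lemma crossed_module_of_strict_linf:
  assumes "strict_linf H A"
  shows "crossed_module H (crossed_of_linf A)"
proof -
  define a0 a1 b1 b00 b01 b10 where
    "a0 = act0 A" and "a1 = act1 A" and "b1 = beta1 A" and
    "b00 = beta200 A" and "b01 = beta201 A" and "b10 = beta210 A"
  note defs = a0_def b00_def a1_def b1_def b01_def b10_def
  have L: "two_term_linf H A" and b3: "beta3 A x y z = tzero H 3 a1" for x y z
    using assms by (simp_all add: strict_linf_def a1_def)
  note L = L [unfolded two_term_linf_def Let_def b3, folded defs]
  have mod: "left_module a0" "left_module a1" "h_linear a1 a0 b1"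
    and pol: "polylinear2 H a0 a0 a0 b00" "polylinear2 H a0 a1 a1 b01"
    and skew: "reorder H a0 [1, 0] (b00 y x) = class_neg (b00 x y)"
      "reorder H a1 [1, 0] (b10 u x) = class_neg (b01 x u)"
    and i: "id_tens H 2 a0 b1 (b01 x u) = b00 x (b1 u)"
    and ii: "b01 (b1 u) v = b10 u (b1 v)"
    and iii: "compose_at H 3 a0 0 (\<lambda>e. b00 e z) (b00 x y)
          \<ominus> compose_at H 3 a0 1 (b00 x) (b00 y z)
          \<oplus> reorder H a0 [1, 0, 2] (compose_at H 3 a0 1 (b00 y) (b00 x z))
          = class_neg (id_tens H 3 a0 b1 (tzero H 3 a1))"
    and iv: "compose_at H 3 a1 0 (\<lambda>e. b01 e v) (b00 x y)
          \<ominus> compose_at H 3 a1 1 (b01 x) (b01 y v)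
          \<oplus> reorder H a1 [1, 0, 2] (compose_at H 3 a1 1 (b01 y) (b01 x v))
          = class_neg (tzero H 3 a1)" for x y z u v
    by (simp_all only: L)
  have lin: "b1 (u + v) = b1 u + b1 v" "b1 (a1 h u) = a0 h (b1 u)" for u v h
    using mod(3) by (simp_all add: h_linear_def)
  have jac0: "compose_at H 3 a0 0 (\<lambda>e. b00 e z) (b00 x y) =
      compose_at H 3 a0 1 (b00 x) (b00 y z)
      \<ominus> reorder H a0 [1, 0, 2] (compose_at H 3 a0 1 (b00 y) (b00 x z))" for x y z
    using iii [of z x y] unfolding id_tens_tzero [OF mod(3)] class_neg_tzero compose_jacobi_iff .
  have rep: "compose_at H 3 a1 0 (\<lambda>e. b01 e v) (b00 x y) =
      compose_at H 3 a1 1 (b01 x) (b01 y v)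
      \<ominus> reorder H a1 [1, 0, 2] (compose_at H 3 a1 1 (b01 y) (b01 x v))" for x y v
    using iv [of v x y] unfolding class_neg_tzero compose_jacobi_iff .
  \<comment> \<open>By (i), \<open>b00 x (b1 u)\<close> is the image of \<open>b01 x u\<close> under
    \<open>b1\<close>. Inserting this image is the same as composing the outer map with
    \<open>b1\<close>.\<close>
  have subst: "compose_at H 3 a1 0 (\<lambda>e. b01 (b1 e) v) (b01 x u) =
      compose_at H 3 a1 0 (\<lambda>e. b01 e v) (b00 x (b1 u))" for x u v
    unfolding i [symmetric]
    by (rule compose_at_id_tens [symmetric, OF slot_linear_0 [OF pol(2) mod(2)]]) simp_all
  \<comment> \<open>This is the last axiom of a crossed module. With \<open>x\<close> of the form
    \<open>b1 w\<close> it is also the Jacobi identity of the bracket on degree 1.\<close>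
  have compat: "compose_at H 3 a1 0 (\<lambda>e. b01 (b1 e) v) (b01 x u) =
      compose_at H 3 a1 1 (b01 x) (b01 (b1 u) v)
      \<ominus> reorder H a1 [1, 0, 2] (compose_at H 3 a1 1 (b01 (b1 u)) (b01 x v))" for x u v
    unfolding subst by (rule rep)
  \<comment> \<open>(ii) rewrites the bracket of v and u as \<open>b10 v (b1 u)\<close>, to which
    skew-symmetry between degrees 1 and 0 applies.\<close>
  have skew': "reorder H a1 [1, 0] (b01 (b1 v) u) = class_neg (b01 (b1 u) v)" for u v
    unfolding ii [of v u] by (rule skew(2))
  have pol': "polylinear2 H a1 a1 a1 (\<lambda>u v. b01 (b1 u) v)"
    using pol(2) by (simp add: polylinear2_def lin)
  show ?thesis
    unfolding crossed_module_def crossed_of_linf_def Let_def lie_pseudoalgebra_def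
      lie_morphism_def lie_representation_def
    unfolding crossed_data.simps lie_data.simps
    unfolding defs [symmetric]
    by (intro conjI allI mod pol pol' skew(1) skew' jac0 compat i rep refl)
qed

lemma strict_linf_of_crossed_module:
  assumes "crossed_module H C"
  obtains A where "strict_linf H A" "crossed_of_linf A = C"
proof -
  define a0 a1 b1 b00 b01 b11 where
    "a0 = act (cm_base C)" and "a1 = act (cm_top C)" and "b1 = cm_map C" and
    "b00 = bracket (cm_base C)" and "b01 = cm_action C" and "b11 = bracket (cm_top C)"
  note defs = a0_def b00_def a1_def b1_def b01_def b11_def
  note C = assms [unfolded crossed_module_def Let_def lie_pseudoalgebra_def
      lie_morphism_def lie_representation_def, folded defs]
  have mod: "left_module a0" "left_module a1" "h_linear a1 a0 b1"
    and pol: "polylinear2 H a0 a0 a0 b00" "polylinear2 H a0 a1 a1 b01"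
    and skew: "reorder H a0 [1, 0] (b00 y x) = class_neg (b00 x y)"
      "reorder H a1 [1, 0] (b11 v u) = class_neg (b11 u v)"
    and jac: "compose_at H 3 a0 0 (\<lambda>e. b00 e z) (b00 x y) =
        compose_at H 3 a0 1 (b00 x) (b00 y z)
        \<ominus> reorder H a0 [1, 0, 2] (compose_at H 3 a0 1 (b00 y) (b00 x z))"
    and rep: "compose_at H 3 a1 0 (\<lambda>e. b01 e u) (b00 x y) =
        compose_at H 3 a1 1 (b01 x) (b01 y u)
        \<ominus> reorder H a1 [1, 0, 2] (compose_at H 3 a1 1 (b01 y) (b01 x u))"
    and i: "id_tens H 2 a0 b1 (b01 x u) = b00 x (b1 u)"
    and ii: "b01 (b1 u) v = b11 u v" for x y z u v
    by (simp_all only: C)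
  \<comment> \<open>The only choice that skew-symmetry with \<open>b01\<close> allows.\<close>
  define b10 where "b10 u x = class_neg (reorder H a1 [1, 0] (b01 x u))" for u x
  define A where "A = \<lparr>act0 = a0, act1 = a1, beta1 = b1, beta200 = b00, beta201 = b01,
    beta210 = b10, beta3 = (\<lambda>x y z. tzero H 3 a1)\<rparr>"
  have in_tens: "b00 x y \<in> tens H 2 a0" "b01 x u \<in> tens H 2 a1" for x y u
    using pol by (simp_all add: polylinear2_def)
  have pol10: "polylinear2 H a1 a0 a1 b10"
    using polylinear2_swap [OF pol(2)] by (simp add: b10_def [abs_def])
  have b10: "b10 u x \<in> tens H 2 a1" for u x
    using pol10 by (simp add: polylinear2_def)
  have skew10: "reorder H a1 [1, 0] (b10 u x) = class_neg (b01 x u)" for u x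
    using reorder_swap_eq_iff [OF b10 in_tens(2)] by (simp only: b10_def)
  \<comment> \<open>Both sides equal \<open>b11 u v\<close>: on the right, the sign and exchange in
    \<open>b10\<close> cancel those from skew-symmetry of \<open>b11\<close>.\<close>
  have ii': "b01 (b1 u) v = b10 u (b1 v)" for u v
    unfolding b10_def ii skew(2) class_neg_neg ..
  have jac': "compose_at H 3 a0 0 (\<lambda>e. b00 e z) (b00 x y)
      \<ominus> compose_at H 3 a0 1 (b00 x) (b00 y z)
      \<oplus> reorder H a0 [1, 0, 2] (compose_at H 3 a0 1 (b00 y) (b00 x z))
      = class_neg (id_tens H 3 a0 b1 (tzero H 3 a1))" for x y z
    unfolding id_tens_tzero [OF mod(3)] class_neg_tzero compose_jacobi_iff by (rule jac)
  have rep': "compose_at H 3 a1 0 (\<lambda>e. b01 e v) (b00 x y)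
      \<ominus> compose_at H 3 a1 1 (b01 x) (b01 y v)
      \<oplus> reorder H a1 [1, 0, 2] (compose_at H 3 a1 1 (b01 y) (b01 x v))
      = class_neg (tzero H 3 a1)" for x y v
    unfolding class_neg_tzero compose_jacobi_iff by (rule rep)
  have compose1: "compose_at H 4 a1 1 (b01 x) (tzero H 3 a1) = tzero H 4 a1" for x
    by (rule compose_at_tzero [OF slot_linear_1 [OF pol(2) mod(1)]]) simp_all
  have compose0: "compose_at H 4 a1 0 (\<lambda>e. tzero H 3 a1) (b00 x y) = tzero H 4 a1" for x y
    by (rule compose_at_zero [OF in_tens(1)]) simp_all
  have reorder4: "reorder H a1 ps (tzero H 4 a1) = tzero H 4 a1"
    if "ps \<in> {[1, 0, 2, 3], [1, 2, 0, 3], [1, 2, 3, 0], [0, 2, 1, 3], [0, 2, 3, 1], [2, 0, 1, 3],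
      [2, 0, 3, 1], [2, 3, 0, 1]}" for ps
    by (rule reorder_tzero) (use that in auto)
  have reorder3: "reorder H a1 ps (tzero H 3 a1) = class_neg (tzero H 3 a1)"
    if "ps \<in> {[1, 0, 2], [0, 2, 1], [2, 1, 0]}" for ps
    unfolding class_neg_tzero by (rule reorder_tzero) (use that in auto)
  have "two_term_linf H A"
    unfolding two_term_linf_def A_def Let_def linf_data.simps
  proof (intro conjI allI mod pol pol10 skew(1) skew10 polylinear3_tzero reorder3 i ii' jac' rep')
    fix x y z w
    show "compose_at H 4 a1 1 (b01 x) (tzero H 3 a1)
          \<ominus> reorder H a1 [1, 0, 2, 3] (compose_at H 4 a1 1 (b01 y) (tzero H 3 a1))
          \<oplus> reorder H a1 [1, 2, 0, 3] (compose_at H 4 a1 1 (b01 z) (tzero H 3 a1))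
          \<ominus> reorder H a1 [1, 2, 3, 0] (compose_at H 4 a1 1 (b01 w) (tzero H 3 a1))
          \<ominus> compose_at H 4 a1 0 (\<lambda>e. tzero H 3 a1) (b00 x y)
          \<oplus> reorder H a1 [0, 2, 1, 3] (compose_at H 4 a1 0 (\<lambda>e. tzero H 3 a1) (b00 x z))
          \<ominus> reorder H a1 [0, 2, 3, 1] (compose_at H 4 a1 0 (\<lambda>e. tzero H 3 a1) (b00 x w))
          \<ominus> reorder H a1 [2, 0, 1, 3] (compose_at H 4 a1 0 (\<lambda>e. tzero H 3 a1) (b00 y z))
          \<oplus> reorder H a1 [2, 0, 3, 1] (compose_at H 4 a1 0 (\<lambda>e. tzero H 3 a1) (b00 y w))
          \<ominus> reorder H a1 [2, 3, 0, 1] (compose_at H 4 a1 0 (\<lambda>e. tzero H 3 a1) (b00 z w))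
          = tzero H 4 a1"
      by (simp only: compose1 compose0 reorder4 tzero_diff tzero_add insert_iff simp_thms)
  qed simp_all
  then have "strict_linf H A"
    by (simp add: strict_linf_def A_def)
  moreover have "crossed_of_linf A = C"
    \<comment> \<open>The top bracket of the image is \<open>b01 (b1 u) v\<close>, which
      \<open>ii\<close> identifies with the given one. The record C is therefore recovered
      exactly.\<close>
    unfolding crossed_of_linf_def A_def linf_data.simps ii
    by (simp add: defs)
  ultimately show thesis
    by (rule that)
qed

text \<open>The correspondence forgets only \<open>beta210\<close> and \<open>beta3\<close>. The
  first is recovered from \<open>beta201\<close> by skew-symmetry; the second is the zero class,
  determined by H and the retained action on degree 1.\<close>

lemma strict_linf_eqI:
  assumes A: "strict_linf H A" and B: "strict_linf H B" and eq: "crossed_of_linf A = crossed_of_linf B"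
  shows "A = B"
proof -
  have eqs: "act0 A = act0 B" "act1 A = act1 B" "beta1 A = beta1 B" "beta200 A = beta200 B"
    "beta201 A = beta201 B"
    using eq by (simp_all add: crossed_of_linf_def)
  have b10: "beta210 X u x = class_neg (reorder H (act1 X) [1, 0] (beta201 X x u))"
    if X: "strict_linf H X" for X :: "('h, 'a, 'b) linf_data" and u x
  proof -
    have "polylinear2 H (act0 X) (act1 X) (act1 X) (beta201 X)"
      and "polylinear2 H (act1 X) (act0 X) (act1 X) (beta210 X)"
      and "reorder H (act1 X) [1, 0] (beta210 X u x) = class_neg (beta201 X x u)"
      by (simp_all only: X [unfolded strict_linf_def two_term_linf_def Let_def])
    then show ?thesis
      unfolding polylinear2_def by (metis reorder_swap_eq_iff)
  qed
  have "beta210 A = beta210 B"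
    by (intro ext) (simp only: b10 [OF A] b10 [OF B] eqs)
  moreover have "beta3 A = beta3 B"
    using A B eqs by (intro ext) (simp add: strict_linf_def)
  ultimately show ?thesis
    using eqs by simp
qed

end

theorem theorem5p8:
  fixes H :: "('k::field, 'h::ring_1) hopf"
  assumes "cocommutative_hopf_algebra H"
  shows "bij_betw
    (crossed_of_linf ::
      ('h, 'a::ab_group_add, 'b::ab_group_add) linf_data \<Rightarrow> ('h, 'a, 'b) crossed_data)
    {A. strict_linf H A} {C. crossed_module H C}"
proof -
  interpret cocommutative_hopf H
    by unfold_locales (rule assms)
  show ?thesis
    unfolding bij_betw_def
  proof
    show "inj_on crossed_of_linf
        {A :: ('h, 'a::ab_group_add, 'b::ab_group_add) linf_data. strict_linf H A}"
      by (rule inj_onI) (auto intro: strict_linf_eqI)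
    show "crossed_of_linf ` {A :: ('h, 'a, 'b) linf_data. strict_linf H A} = {C. crossed_module H C}"
    proof (intro equalityI subsetI)
      fix C :: "('h, 'a, 'b) crossed_data"
      assume "C \<in> {C. crossed_module H C}"
      then obtain A where "strict_linf H A" "crossed_of_linf A = C"
        by (auto elim: strict_linf_of_crossed_module)
      then show "C \<in> crossed_of_linf ` {A. strict_linf H A}"
        by blast
    qed (auto intro: crossed_module_of_strict_linf)
  qed
qed

end
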